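(* Let $0<\alpha<1$. Consider the piston problem for the modified Chaplygin gas in coordinates moving with the piston: in the domain $\Omega=\{(t,x): x<0,\ t>0\}$, $$\rho_t+(\rho u)_x=0,\qquad (\rho u)_t+(\rho u^2+P)_x=0,\qquad P=A\rho-\frac{B}{\rho^{\alpha}},$$ with initial condition $(\rho,u)|_{t=0}=(1,-v_0)$ for $x<0$ and boundary condition $\rho u=0$ on $x=0$. For $v_0=\sqrt2$ and any fixed $A>0$ and $B>0$, as the piston recedes from the modified Chaplygin gas, for any Mach number $M_0\in(0,\infty)$ (where $A+B\alpha=\frac{2}{M_0^2}$), only one physically relevant rarefaction wave solution will be present in front of the piston to connect the two states $V_0=(1,-\sqrt2)$ and $V_1=(\rho_1,0)$ in the domain $\Omega$, and concentration will never occur.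
   Context: Here $\rho$ is the density, $u$ the velocity relative to the piston, $P$ the pressure, and $v_0$ the constant velocity of the piston; the gas lies to the left of the piston, so $v_0>0$ means that the piston recedes from the gas. The variables are non-dimensionalized so that the initial density is $\rho_0=1$ and $v_0=\pm\sqrt2$. The Mach number of the piston is $M_0=|v_0|/c_0$ with $c_0=\sqrt{P'(\rho_0)}=\sqrt{A+B\alpha}$, which gives $A+B\alpha=2/M_0^2$. The system has eigenvalues $\lambda_1=u-\sqrt{A+\frac{B\alpha}{\rho^{\alpha+1}}}$ and $\lambda_2=u+\sqrt{A+\frac{B\alpha}{\rho^{\alpha+1}}}$. A rarefaction wave solution connecting $V_0$ and $V_1$ is a self-similar solution $(\rho,u)(t,x)=V(x/t)$ which, for $i=1$ or $i=2$, equals $V_0$ for $x/t<\lambda_i(V_0)$, equals a centered rarefaction wave $V_m(x/t)$ of the $i$-th family (a smooth solution with $\lambda_i(V_m(x/t))=x/t$) for $\lambda_i(V_0)\le x/t<\lambda_i(V_1)$, and equals $V_1$ for $\lambda_i(V_1)<x/t\le 0$. "Physically relevant" refers to the requirements imposed for a receding piston, namely that the gas is rarefied, $\rho_1<\rho_0=1$, and that $\lambda_i(V_0)\le\lambda_i(U)\le\lambda_i(V_1)$ for states $U$ in the wave. "Concentration" means concentration of mass on the piston in the form of a Dirac measure. *)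

theory Defs
  imports "HOL-Analysis.Analysis"
begin

text \<open>
  Points of the space-time plane are pairs \<open>(t, x)\<close>; states of the gas are pairs \<open>(\<rho>, u)\<close>, with
  \<open>u\<close> the velocity relative to the piston, which sits at \<open>x = 0\<close>.
\<close>

definition pressure :: "real \<Rightarrow> real \<Rightarrow> real \<Rightarrow> real \<Rightarrow> real" where
  "pressure A B \<alpha> \<rho> = A * \<rho> - B / \<rho> powr \<alpha>"

definition eigenvalue :: "real \<Rightarrow> real \<Rightarrow> real \<Rightarrow> nat \<Rightarrow> real \<times> real \<Rightarrow> real" where
  "eigenvalue A B \<alpha> i = (\<lambda>(\<rho>, u).
     if i = 1 then u - sqrt (A + B * \<alpha> / \<rho> powr (\<alpha> + 1))
     else u + sqrt (A + B * \<alpha> / \<rho> powr (\<alpha> + 1)))"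

definition mach_number :: "real \<Rightarrow> real \<Rightarrow> real \<Rightarrow> real \<Rightarrow> real" where
  "mach_number A B \<alpha> v0 = \<bar>v0\<bar> / sqrt (deriv (pressure A B \<alpha>) 1)"

lemma deriv_pressure:
  assumes "\<rho> > 0"
  shows "deriv (pressure A B \<alpha>) \<rho> = A + B * \<alpha> / \<rho> powr (\<alpha> + 1)"
proof (rule DERIV_imp_deriv)
  have *: "((\<lambda>r. A * r - B * r powr (-\<alpha>)) has_real_derivative
          A - B * (-\<alpha> * \<rho> powr (-\<alpha> - 1))) (at \<rho>)"
    using assms by (auto intro!: derivative_eq_intros)
  have "pressure A B \<alpha> = (\<lambda>r. A * r - B * r powr (-\<alpha>))"
    by (auto simp: pressure_def powr_minus field_simps)
  moreover have "A - B * (-\<alpha> * \<rho> powr (-\<alpha> - 1)) = A + B * \<alpha> / \<rho> powr (\<alpha> + 1)"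
    using powr_minus_divide[of \<rho> "\<alpha> + 1"] by (simp add: minus_diff_commute)
  ultimately show "(pressure A B \<alpha> has_real_derivative A + B * \<alpha> / \<rho> powr (\<alpha> + 1)) (at \<rho>)"
    using * by simp
qed

lemma mach_number_eq_iff:
  assumes "A > 0" "B > 0" "\<alpha> > 0" "M > 0"
  shows "mach_number A B \<alpha> (sqrt 2) = M \<longleftrightarrow> A + B * \<alpha> = 2 / M\<^sup>2"
proof -
  have pos: "A + B * \<alpha> > 0"
    using assms by (simp add: add_pos_pos)
  have eq: "mach_number A B \<alpha> (sqrt 2) = sqrt (2 / (A + B * \<alpha>))"
    by (simp add: mach_number_def deriv_pressure real_sqrt_divide)
  have "sqrt (2 / (A + B * \<alpha>)) = M \<longleftrightarrow> 2 / (A + B * \<alpha>) = M\<^sup>2"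
    using assms(4) pos
    by (metis less_eq_real_def real_sqrt_pow2 real_sqrt_unique zero_le_divide_iff zero_le_numeral)
  also have "\<dots> \<longleftrightarrow> A + B * \<alpha> = 2 / M\<^sup>2"
    using assms(4) pos by (auto simp: field_simps)
  finally show ?thesis
    using eq by simp
qed

definition gas_domain :: "(real \<times> real) set" where
  "gas_domain = {(t, x). t > 0 \<and> x < 0}"

definition piston_path :: "(real \<times> real) set" where
  "piston_path = {(t, x). t > 0 \<and> x = 0}"

definition d_t :: "(real \<times> real \<Rightarrow> real) \<Rightarrow> real \<times> real \<Rightarrow> real" where
  "d_t \<phi> = (\<lambda>(t, x). deriv (\<lambda>s. \<phi> (s, x)) t)"

definition d_x :: "(real \<times> real \<Rightarrow> real) \<Rightarrow> real \<times> real \<Rightarrow> real" where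
  "d_x \<phi> = (\<lambda>(t, x). deriv (\<lambda>y. \<phi> (t, y)) x)"

text \<open>
  Continuously differentiable functions with compact support in the whole plane; in particular they
  need not vanish for \<open>t = 0\<close> or \<open>x = 0\<close>.
\<close>

definition test_function :: "(real \<times> real \<Rightarrow> real) \<Rightarrow> bool" where
  "test_function \<phi> \<longleftrightarrow>
     (\<forall>t x. (\<lambda>s. \<phi> (s, x)) differentiable (at t) \<and> (\<lambda>y. \<phi> (t, y)) differentiable (at x)) \<and>
     continuous_on UNIV \<phi> \<and> continuous_on UNIV (d_t \<phi>) \<and> continuous_on UNIV (d_x \<phi>) \<and>
     compact (closure {z. \<phi> z \<noteq> 0})"

text \<open>
  Radon measure solutions of the piston problem with initial state \<open>(1, -v0)\<close>. The Radon measure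
  \<open>\<mu>\<close> is the mass distribution in space-time. In the open gas domain it has the density \<open>\<rho>\<close>, but it
  is not prescribed on the piston path, so that a Dirac part \<open>w(t) \<delta>\<close> carried by \<open>x = 0\<close> is
  admitted. The momentum is the measure \<open>u \<mu>\<close>.

  The boundary condition \<open>\<rho> u = 0\<close> on \<open>x = 0\<close> enters twice: mass on the piston does not move
  relative to it, and the mass balance is tested with functions that need not vanish on \<open>x = 0\<close>,
  so no mass leaves through the piston. It does not by itself rule out a Dirac part: gas of constant
  state \<open>(1, -v0)\<close> hitting an advancing piston (\<open>v0 < 0\<close>) satisfies the mass balance with
  \<open>w(t) = -v0 t\<close>. The force between gas and piston is unknown, therefore the momentum balance is
  tested only with functions vanishing on \<open>x = 0\<close>.
\<close>

definition piston_solution ::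
    "real \<Rightarrow> real \<Rightarrow> real \<Rightarrow> real \<Rightarrow> (real \<times> real) measure \<Rightarrow>
     (real \<times> real \<Rightarrow> real) \<Rightarrow> (real \<times> real \<Rightarrow> real) \<Rightarrow> bool" where
  "piston_solution A B \<alpha> v0 \<mu> \<rho> u \<longleftrightarrow>
     sets \<mu> = sets borel \<and>
     (\<forall>K. compact K \<longrightarrow> emeasure \<mu> K < \<infinity>) \<and>
     emeasure \<mu> (- (gas_domain \<union> piston_path)) = 0 \<and>
     \<rho> \<in> borel_measurable (restrict_space borel (gas_domain \<union> piston_path)) \<and>
     u \<in> borel_measurable (restrict_space borel (gas_domain \<union> piston_path)) \<and>
     (\<forall>z \<in> gas_domain \<union> piston_path. \<rho> z > 0) \<and>
     (\<forall>E \<in> sets borel. E \<subseteq> gas_domain \<longrightarrow>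
        emeasure \<mu> E = (\<integral>\<^sup>+ z \<in> E. ennreal (\<rho> z) \<partial>lborel)) \<and>
     (\<forall>z \<in> piston_path. \<rho> z * u z = 0) \<and>
     (\<forall>\<phi>. test_function \<phi> \<longrightarrow>
        set_integrable \<mu> (gas_domain \<union> piston_path) (\<lambda>z. d_t \<phi> z + u z * d_x \<phi> z) \<and>
        (LINT z:gas_domain \<union> piston_path|\<mu>. d_t \<phi> z + u z * d_x \<phi> z)
          + (LINT x:{..<0}|lborel. \<phi> (0, x)) = 0) \<and>
     (\<forall>\<phi>. test_function \<phi> \<and> (\<forall>t. \<phi> (t, 0) = 0) \<longrightarrow>
        set_integrable \<mu> (gas_domain \<union> piston_path)
          (\<lambda>z. u z * d_t \<phi> z + (u z)\<^sup>2 * d_x \<phi> z) \<and>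
        set_integrable lborel gas_domain (\<lambda>z. pressure A B \<alpha> (\<rho> z) * d_x \<phi> z) \<and>
        (LINT z:gas_domain \<union> piston_path|\<mu>. u z * d_t \<phi> z + (u z)\<^sup>2 * d_x \<phi> z)
          + (LINT z:gas_domain|lborel. pressure A B \<alpha> (\<rho> z) * d_x \<phi> z)
          + (LINT x:{..<0}|lborel. - v0 * \<phi> (0, x)) = 0)"

definition concentrates_on_piston :: "(real \<times> real) measure \<Rightarrow> bool" where
  "concentrates_on_piston \<mu> \<longleftrightarrow> emeasure \<mu> piston_path > 0"

definition classical_solution_on ::
    "real \<Rightarrow> real \<Rightarrow> real \<Rightarrow> (real \<times> real) set \<Rightarrow>
     (real \<times> real \<Rightarrow> real) \<Rightarrow> (real \<times> real \<Rightarrow> real) \<Rightarrow> bool" where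
  "classical_solution_on A B \<alpha> D \<rho> u \<longleftrightarrow>
     (\<forall>(t, x) \<in> D. \<exists>a b a' b'.
        ((\<lambda>s. \<rho> (s, x)) has_real_derivative a) (at t) \<and>
        ((\<lambda>y. \<rho> (t, y) * u (t, y)) has_real_derivative b) (at x) \<and>
        a + b = 0 \<and>
        ((\<lambda>s. \<rho> (s, x) * u (s, x)) has_real_derivative a') (at t) \<and>
        ((\<lambda>y. \<rho> (t, y) * (u (t, y))\<^sup>2 + pressure A B \<alpha> (\<rho> (t, y))) has_real_derivative b') (at x) \<and>
        a' + b' = 0)"

text \<open>
  The profile \<open>V\<close> is relevant only on \<open>{..0}\<close>, the range of \<open>x / t\<close> in the closed domain. Its
  continuity says that the centered wave really joins the two constant states; it also fixes the value
  at \<open>\<xi> = \<lambda>\<^sub>i(V\<^sub>1)\<close>.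
\<close>

definition rarefaction_wave_solution ::
    "real \<Rightarrow> real \<Rightarrow> real \<Rightarrow> real \<Rightarrow> nat \<Rightarrow> real \<Rightarrow> (real \<Rightarrow> real \<times> real) \<Rightarrow>
     (real \<times> real) measure \<Rightarrow> bool" where
  "rarefaction_wave_solution A B \<alpha> v0 i \<rho>1 V \<mu> \<longleftrightarrow>
     (let V0 = (1, - v0); V1 = (\<rho>1, 0);
          l0 = eigenvalue A B \<alpha> i V0; l1 = eigenvalue A B \<alpha> i V1;
          \<rho> = (\<lambda>(t, x). fst (V (x / t))); u = (\<lambda>(t, x). snd (V (x / t)))
      in i \<in> {1, 2} \<and> \<rho>1 > 0 \<and>
         continuous_on {..0} V \<and>
         (\<forall>\<xi> \<le> 0. \<xi> < l0 \<longrightarrow> V \<xi> = V0) \<and>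
         (\<forall>\<xi> \<le> 0. l0 \<le> \<xi> \<and> \<xi> < l1 \<longrightarrow> eigenvalue A B \<alpha> i (V \<xi>) = \<xi>) \<and>
         (\<forall>\<xi> \<le> 0. l1 < \<xi> \<longrightarrow> V \<xi> = V1) \<and>
         V C1_differentiable_on ({l0<..<l1} \<inter> {..<0}) \<and>
         classical_solution_on A B \<alpha> {(t, x) \<in> gas_domain. l0 < x / t \<and> x / t < l1} \<rho> u \<and>
         piston_solution A B \<alpha> v0 \<mu> \<rho> u)"

definition physically_relevant ::
    "real \<Rightarrow> real \<Rightarrow> real \<Rightarrow> real \<Rightarrow> nat \<Rightarrow> real \<Rightarrow> (real \<Rightarrow> real \<times> real) \<Rightarrow> bool" where
  "physically_relevant A B \<alpha> v0 i \<rho>1 V \<longleftrightarrow>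
     \<rho>1 < 1 \<and>
     (\<forall>U \<in> V ` {..0}. eigenvalue A B \<alpha> i (1, - v0) \<le> eigenvalue A B \<alpha> i U \<and>
                     eigenvalue A B \<alpha> i U \<le> eigenvalue A B \<alpha> i (\<rho>1, 0))"

end

theory Submission
  imports Defs
begin

text \<open>
  Along a rarefaction of the first family \<open>u + \<integral> c(\<rho>)/\<rho> d\<rho>\<close> is constant, where
  \<open>c = sqrt (A + B \<alpha> / \<rho>^(\<alpha> + 1))\<close> is the speed of sound. The integral diverges at vacuum because
  \<open>c > sqrt A\<close>, so there is exactly one density \<open>\<rho>\<^sub>1\<close> at which the velocity has risen from \<open>- v0\<close> to
  \<open>0\<close>, and \<open>\<rho>\<^sub>1 < 1\<close>. Since \<open>\<lambda>\<^sub>1\<close> is strictly decreasing in \<open>\<rho>\<close> on this curve, the wave is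
  obtained by inverting it. Conversely, the mass equation together with \<open>\<lambda>\<^sub>1(V(\<xi>)) = \<xi>\<close> forces the
  invariant to be constant, while a wave of the second family is impossible because \<open>\<lambda>\<^sub>2 = c > 0\<close> at
  the piston. Integration by parts shows that the gas alone satisfies the weak mass balance up to the
  piston, which leaves no mass for a Dirac part there.
\<close>

text \<open>The weak balance laws are the laborious part. The profile has kinks along the rays x/t =
  l0 and x/t = l1, and the derivatives of the fan are of order 1/t at the corner (0, 0), where all
  its rays meet, so integration by parts over the domain needs care.
  \<open>self_similar_balance\<close> deals with both obstacles once, for a conserved profile f with
  flux g and g' = \<xi> f': mass is the case f = R, g = R U, and momentum the case f = R U, g = R
  U^2 + P. The mass identity has two uses. It verifies that the constructed wave is a solution, and
  it is subtracted from the weak mass balance of an arbitrary solution with the same profile, whose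
  measure on the piston is free a priori. This is why the statement about concentration rests on
  uniqueness of the profile. The integral of c/\<rho> has a closed form, but the eigenvalue along
  the wave curve is inverted only implicitly, so the profile is an \<open>inv_into\<close> and its
  derivative comes from the inverse function rule.\<close>

lemma test_function_DERIV:
  assumes "test_function \<phi>"
  shows "((\<lambda>s. \<phi> (s, x)) has_real_derivative d_t \<phi> (t, x)) (at t)"
    and "((\<lambda>y. \<phi> (t, y)) has_real_derivative d_x \<phi> (t, x)) (at x)"
  using assms unfolding test_function_def d_t_def d_x_def
  by (auto simp: DERIV_deriv_iff_real_differentiable)

lemma continuous_zero_outside_compact_bounded:
  fixes h :: "'a::topological_space \<Rightarrow> real"
  assumes "continuous_on UNIV h" "compact K" "\<And>z. z \<notin> K \<Longrightarrow> h z = 0"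
  shows "\<exists>C>0. \<forall>z. \<bar>h z\<bar> \<le> C"
proof -
  have "bounded (h ` K)"
    using assms by (meson compact_continuous_image compact_imp_bounded continuous_on_subset subset_UNIV)
  then obtain C where C: "C > 0" "\<forall>y\<in>h ` K. norm y \<le> C"
    using bounded_pos by blast
  have "\<bar>h z\<bar> \<le> C" for z
    using C assms(3)[of z] by (cases "z \<in> K") auto
  with C show ?thesis by blast
qed

text \<open>The complement of the support is open, so \<open>\<phi>\<close> vanishes near every
  outside point and its partial derivatives vanish there too. One bound \<open>C\<close> and one box
  of half-width \<open>T\<close> then serve all three functions.\<close>

lemma test_function_bounds:
  assumes \<phi>: "test_function \<phi>"
  obtains C T where "C > 0" "T > 0"
    "\<And>z. \<bar>\<phi> z\<bar> \<le> C" "\<And>z. \<bar>d_t \<phi> z\<bar> \<le> C" "\<And>z. \<bar>d_x \<phi> z\<bar> \<le> C"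
    "\<And>t x. T \<le> \<bar>t\<bar> \<or> T \<le> \<bar>x\<bar> \<Longrightarrow> \<phi> (t, x) = 0 \<and> d_t \<phi> (t, x) = 0 \<and> d_x \<phi> (t, x) = 0"
proof -
  define K where "K = closure {z. \<phi> z \<noteq> 0}"
  have K: "compact K" and cont: "continuous_on UNIV \<phi>" "continuous_on UNIV (d_t \<phi>)"
      "continuous_on UNIV (d_x \<phi>)"
    using \<phi> by (simp_all only: test_function_def K_def)
  have z0: "\<phi> z = 0" if "z \<notin> K" for z
    using that closure_subset[of "{z. \<phi> z \<noteq> 0}"] unfolding K_def by blast
  have op: "open (- K)"
    using K by (simp add: compact_imp_closed open_Compl)
  have dt0: "d_t \<phi> z = 0" if "z \<notin> K" for z
  proof -
    obtain t x where z: "z = (t, x)" by (cases z)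
    have "open ((\<lambda>s. (s, x)) -` (- K))"
      by (intro continuous_open_vimage op) (auto intro!: continuous_intros)
    then have "((\<lambda>s. \<phi> (s, x)) has_real_derivative 0) (at t)"
      by (rule has_field_derivative_transform_within_open[where f="\<lambda>s. 0", rotated])
        (use that z z0 in auto)
    then show ?thesis
      using DERIV_unique[OF test_function_DERIV(1)[OF \<phi>, of x t]] z by simp
  qed
  have dx0: "d_x \<phi> z = 0" if "z \<notin> K" for z
  proof -
    obtain t x where z: "z = (t, x)" by (cases z)
    have "open ((\<lambda>s. (t, s)) -` (- K))"
      by (intro continuous_open_vimage op) (auto intro!: continuous_intros)
    then have "((\<lambda>s. \<phi> (t, s)) has_real_derivative 0) (at x)"
      by (rule has_field_derivative_transform_within_open[where f="\<lambda>s. 0", rotated])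
        (use that z z0 in auto)
    then show ?thesis
      using DERIV_unique[OF test_function_DERIV(2)[OF \<phi>, of t x]] z by simp
  qed
  obtain C1 C2 C3 where C: "C1 > 0" "\<forall>z. \<bar>\<phi> z\<bar> \<le> C1" "C2 > 0" "\<forall>z. \<bar>d_t \<phi> z\<bar> \<le> C2"
      "C3 > 0" "\<forall>z. \<bar>d_x \<phi> z\<bar> \<le> C3"
    using continuous_zero_outside_compact_bounded[OF cont(1) K z0]
      continuous_zero_outside_compact_bounded[OF cont(2) K dt0]
      continuous_zero_outside_compact_bounded[OF cont(3) K dx0] by blast
  obtain b where b: "b > 0" "\<forall>z\<in>K. norm z \<le> b"
    using K compact_imp_bounded bounded_pos by blast
  \<comment> \<open>\<open>K\<close> lies in the closed ball of radius \<open>b\<close>; the extra 1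
    puts even points with |t| = b + 1 strictly outside.\<close>
  have out: "(t, x) \<notin> K" if "b + 1 \<le> \<bar>t\<bar> \<or> b + 1 \<le> \<bar>x\<bar>" for t x
    using b(2) that norm_fst_le[of t x] norm_snd_le[of x t] by fastforce
  show thesis
  proof (rule that[of "C1 + C2 + C3" "b + 1"])
    show "\<phi> (t, x) = 0 \<and> d_t \<phi> (t, x) = 0 \<and> d_x \<phi> (t, x) = 0"
      if "b + 1 \<le> \<bar>t\<bar> \<or> b + 1 \<le> \<bar>x\<bar>" for t x
      using out[OF that] z0 dt0 dx0 by blast
    show "\<bar>\<phi> z\<bar> \<le> C1 + C2 + C3" "\<bar>d_t \<phi> z\<bar> \<le> C1 + C2 + C3" "\<bar>d_x \<phi> z\<bar> \<le> C1 + C2 + C3" for z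
      using C(1,3,5) spec[OF C(2), of z] spec[OF C(4), of z] spec[OF C(6), of z] by linarith+
  qed (use C(1,3,5) b(1) in linarith)+
qed

lemma borel_measurable_fst_snd [measurable]:
  "(fst :: real \<times> real \<Rightarrow> real) \<in> borel_measurable borel"
  "(snd :: real \<times> real \<Rightarrow> real) \<in> borel_measurable borel"
  by (auto intro!: borel_measurable_continuous_onI continuous_intros)

lemma gas_domain_borel [measurable]: "gas_domain \<in> sets borel"
proof -
  have "gas_domain = {0<..} \<times> {..<0}" by (auto simp: gas_domain_def)
  moreover have "open ({0<..} \<times> {..<0} :: (real \<times> real) set)" by (intro open_Times) auto
  ultimately show ?thesis by (metis borel_open)
qed

lemma piston_path_borel [measurable]: "piston_path \<in> sets borel"
proof -
  have "piston_path = {0<..} \<times> {0}" by (auto simp: piston_path_def)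
  then show ?thesis using borel_Times[of "{0::real<..}" "{0::real}"] by simp
qed

lemma integrable_bounded_box:
  fixes h :: "real \<times> real \<Rightarrow> real"
  assumes "h \<in> borel_measurable borel" "\<And>z. \<bar>h z\<bar> \<le> C"
    and "\<And>t x. T \<le> \<bar>t\<bar> \<or> T \<le> \<bar>x\<bar> \<Longrightarrow> h (t, x) = 0"
  shows "integrable lborel h"
proof -
  have 0: "h z = 0" if z: "z \<notin> cbox (- T, - T) (T, T)" for z
    using z by (cases z) (auto simp: cbox_Pair_eq intro!: assms(3))
  have "emeasure lborel (cbox (- T, - T) (T, T)) < \<infinity>"
    using emeasure_lborel_cbox_finite by (metis infinity_ennreal_def)
  then show ?thesis
    using assms 0 by (intro integrableI_bounded_set[where A="cbox (-T,-T) (T,T)" and B=C]) auto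
qed

lemma borel_measurable_test_function:
  assumes "test_function \<phi>"
  shows "\<phi> \<in> borel_measurable borel" "d_t \<phi> \<in> borel_measurable borel" "d_x \<phi> \<in> borel_measurable borel"
  using assms unfolding test_function_def by (auto intro: borel_measurable_continuous_onI)

lemma set_integrable_test_derivative:
  assumes \<phi>: "test_function \<phi>" and w: "w \<in> borel_measurable borel" "\<And>z. \<bar>w z\<bar> \<le> K"
    and S: "S \<in> sets borel"
  shows "set_integrable lborel S (\<lambda>z. w z * d_t \<phi> z)"
    and "set_integrable lborel S (\<lambda>z. w z * d_x \<phi> z)"
proof -
  obtain C T where C: "C > 0" "T > 0"
    "\<And>z. \<bar>\<phi> z\<bar> \<le> C" "\<And>z. \<bar>d_t \<phi> z\<bar> \<le> C" "\<And>z. \<bar>d_x \<phi> z\<bar> \<le> C"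
    "\<And>t x. T \<le> \<bar>t\<bar> \<or> T \<le> \<bar>x\<bar> \<Longrightarrow> \<phi> (t, x) = 0 \<and> d_t \<phi> (t, x) = 0 \<and> d_x \<phi> (t, x) = 0"
    using test_function_bounds[OF \<phi>] by metis
  note [measurable] = borel_measurable_test_function[OF \<phi>] w(1) S
  have K: "\<bar>w z * y\<bar> \<le> K * C" if "\<bar>y\<bar> \<le> C" for z y
    unfolding abs_mult by (rule mult_mono) (use w(2)[of z] that in auto)
  have K0: "0 \<le> K * C" using K[of 0 "(0, 0)"] C(1) by simp
  have out: "w (t, x) * d_t \<phi> (t, x) = 0" "w (t, x) * d_x \<phi> (t, x) = 0"
    if "T \<le> \<bar>t\<bar> \<or> T \<le> \<bar>x\<bar>" for t x
    using C(6)[OF that] by simp_all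
  have "integrable lborel (\<lambda>z. indicator S z * (w z * d_t \<phi> z))"
    by (rule integrable_bounded_box[where C="K * C" and T=T])
      (use K[OF C(4)] K0 out in \<open>auto simp: indicator_def\<close>)
  then show "set_integrable lborel S (\<lambda>z. w z * d_t \<phi> z)"
    by (simp add: set_integrable_def)
  have "integrable lborel (\<lambda>z. indicator S z * (w z * d_x \<phi> z))"
    by (rule integrable_bounded_box[where C="K * C" and T=T])
      (use K[OF C(5)] K0 out in \<open>auto simp: indicator_def\<close>)
  then show "set_integrable lborel S (\<lambda>z. w z * d_x \<phi> z)"
    by (simp add: set_integrable_def)
qed

section \<open>Weak balance laws of self-similar flows\<close>

text \<open>The relation g' = \<xi> f' is the equation f(x/t)_t + g(x/t)_x = 0 in the similarity
  variable. The integrand is split into a t-derivative \<open>W1\<close> of f \<phi> and an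
  x-derivative \<open>W2\<close> of g \<phi>. Each is integrated along its own variable, where the
  two kinks are a finite exceptional set for the fundamental theorem of calculus. The assumption
  \<open>bdry\<close> covers both a flux that vanishes on the piston and a test function that
  does.\<close>

lemma self_similar_balance:
  fixes f g f' :: "real \<Rightarrow> real"
  assumes l: "l0 < l1" "l1 < 0"
    and cont: "continuous_on UNIV f" "continuous_on UNIV g"
    and f': "\<And>\<xi>. \<xi> \<notin> {l0, l1} \<Longrightarrow> (f has_real_derivative f' \<xi>) (at \<xi>)"
    and g': "\<And>\<xi>. \<xi> \<notin> {l0, l1} \<Longrightarrow> (g has_real_derivative \<xi> * f' \<xi>) (at \<xi>)"
    and f'_meas: "f' \<in> borel_measurable borel"
    and f'_bound: "\<And>\<xi>. \<bar>f' \<xi>\<bar> \<le> K" and f'_zero: "\<And>\<xi>. \<xi> \<notin> {l0..l1} \<Longrightarrow> f' \<xi> = 0"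
    and f0: "\<And>\<xi>. \<xi> < l0 \<Longrightarrow> f \<xi> = f0"
    and bound: "\<And>\<xi>. \<bar>f \<xi>\<bar> \<le> K'" "\<And>\<xi>. \<bar>g \<xi>\<bar> \<le> K'"
    and \<phi>: "test_function \<phi>" and bdry: "\<And>t. g 0 * \<phi> (t, 0) = 0"
  shows "(LINT z:gas_domain|lborel. f (snd z / fst z) * d_t \<phi> z + g (snd z / fst z) * d_x \<phi> z)
    + (LINT x:{..<0}|lborel. f0 * \<phi> (0, x)) = 0"
proof -
  obtain C T where CT: "C > 0" "T > 0"
    and C: "\<And>z. \<bar>\<phi> z\<bar> \<le> C"
    and T: "\<And>t x. T \<le> \<bar>t\<bar> \<or> T \<le> \<bar>x\<bar> \<Longrightarrow> \<phi> (t, x) = 0 \<and> d_t \<phi> (t, x) = 0 \<and> d_x \<phi> (t, x) = 0"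
    using test_function_bounds[OF \<phi>] by metis
  have \<phi>_cont: "continuous_on UNIV \<phi>"
    using \<phi> by (simp only: test_function_def)
  have [measurable]: "f \<in> borel_measurable borel" "g \<in> borel_measurable borel"
    using cont by (auto intro: borel_measurable_continuous_onI)
  note [measurable] = borel_measurable_test_function[OF \<phi>] f'_meas
  \<comment> \<open>Off the kinks, q is both \<phi> times the x-derivative of g(x/t) and minus
    \<phi> times the t-derivative of f(x/t). Subtracting it from one half of the integrand and
    adding it to the other makes each half a total derivative without changing the sum.\<close>
  define q where "q z = \<phi> z * f' (snd z / fst z) * (snd z / (fst z)\<^sup>2)" for z
  have [measurable]: "q \<in> borel_measurable borel"
    unfolding q_def by measurable
  have K: "K \<ge> 0" using f'_bound[of 0] by linarith

  \<comment> \<open>On the wedge l0 <= x/t <= l1 < 0 one has |x/t| <= |l0|, so |q| <= M/t. At time t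
    the wedge has width (l1 - l0) t, which cancels the singularity: the inner integral of |q| is
    bounded by M (l1 - l0), and q is integrable up to the corner.\<close>
  define M where "M = C * K * \<bar>l0\<bar>"
  have M: "M \<ge> 0" using CT(1) K by (simp add: M_def)
  have q_bound: "ennreal (norm (indicator gas_domain (t, x) * q (t, x)))
      \<le> ennreal (M / t) * indicator {l0 * t..l1 * t} x" if t: "0 < t" for t x
  proof (cases "x / t \<in> {l0..l1} \<and> x < 0")
    case True
    then have "\<bar>x / t\<bar> \<le> \<bar>l0\<bar>" using t l by auto
    then have "\<bar>\<phi> (t, x)\<bar> * \<bar>f' (x / t)\<bar> * \<bar>x / t\<bar> \<le> M"
      unfolding M_def using C f'_bound CT(1) K by (intro mult_mono) auto
    then have "\<bar>\<phi> (t, x)\<bar> * \<bar>f' (x / t)\<bar> * \<bar>x / t\<bar> / t \<le> M / t"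
      using t by (intro divide_right_mono) auto
    moreover have "\<bar>q (t, x)\<bar> = \<bar>\<phi> (t, x)\<bar> * \<bar>f' (x / t)\<bar> * \<bar>x / t\<bar> / t"
      using t by (simp add: q_def abs_mult power2_eq_square)
    ultimately have "\<bar>q (t, x)\<bar> \<le> M / t" by simp
    moreover have "l0 * t \<le> x" "x \<le> l1 * t" using True t by (auto simp: field_simps)
    ultimately show ?thesis
      using True t by (auto simp: indicator_def gas_domain_def intro: ennreal_leI)
  next
    case False
    then have zero: "indicator gas_domain (t, x) * q (t, x) = 0"
      using f'_zero by (auto simp: q_def gas_domain_def indicator_def)
    show ?thesis by (simp only: zero norm_zero ennreal_0 nn_integral_const mult_zero_left zero_le)
  qed
  have q_inner: "(\<integral>\<^sup>+x. ennreal (norm (indicator gas_domain (t, x) * q (t, x))) \<partial>lborel)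
      \<le> ennreal (M * (l1 - l0)) * indicator {0<..<T} t" for t
  proof (cases "0 < t \<and> t < T")
    case True
    then have t: "0 < t" "t < T" by auto
    have "(\<integral>\<^sup>+x. ennreal (norm (indicator gas_domain (t, x) * q (t, x))) \<partial>lborel)
        \<le> (\<integral>\<^sup>+x. ennreal (M / t) * indicator {l0 * t..l1 * t} x \<partial>lborel)"
      by (intro nn_integral_mono q_bound t)
    also have "\<dots> = ennreal (M / t) * ennreal (l1 * t - l0 * t)"
      using l t by (subst nn_integral_cmult_indicator) auto
    also have "\<dots> = ennreal (M / t * (l1 * t - l0 * t))"
      using M t l by (intro ennreal_mult[symmetric]) auto
    also have "M / t * (l1 * t - l0 * t) = M * (l1 - l0)"
      using t by (simp add: field_simps)
    finally show ?thesis using t by simp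
  next
    case False
    then have zero: "indicator gas_domain (t, x) * q (t, x) = 0" for x
      using T[of t x] by (auto simp: q_def gas_domain_def indicator_def)
    show ?thesis by (simp only: zero norm_zero ennreal_0 nn_integral_const mult_zero_left zero_le)
  qed
  have q_int: "integrable lborel (\<lambda>z. indicator gas_domain z * q z)"
  proof (rule integrableI_bounded)
    show "(\<lambda>z. indicator gas_domain z * q z) \<in> borel_measurable lborel"
      by measurable
    have "(\<integral>\<^sup>+z. ennreal (norm (indicator gas_domain z * q z)) \<partial>lborel)
        = (\<integral>\<^sup>+t. \<integral>\<^sup>+x. ennreal (norm (indicator gas_domain (t, x) * q (t, x))) \<partial>lborel \<partial>lborel)"
      unfolding lborel_prod[symmetric] by (rule lborel.nn_integral_fst[symmetric]) (simp add: lborel_prod borel_prod)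
    also have "\<dots> \<le> (\<integral>\<^sup>+t. ennreal (M * (l1 - l0)) * indicator {0<..<T} t \<partial>lborel)"
      by (intro nn_integral_mono q_inner)
    also have "\<dots> = ennreal (M * (l1 - l0)) * ennreal T"
      using CT by (subst nn_integral_cmult_indicator) auto
    also have "\<dots> < \<infinity>" by (simp add: ennreal_mult_less_top)
    finally show "(\<integral>\<^sup>+z. ennreal (norm (indicator gas_domain z * q z)) \<partial>lborel) < \<infinity>" .
  qed

  define W1 where "W1 t x = indicator gas_domain (t, x) * (f (x / t) * d_t \<phi> (t, x) - q (t, x))" for t x
  define W2 where "W2 t x = indicator gas_domain (t, x) * (g (x / t) * d_x \<phi> (t, x) + q (t, x))" for t x
  have fm: "(\<lambda>z. f (snd z / fst z)) \<in> borel_measurable borel"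
    and gm: "(\<lambda>z. g (snd z / fst z)) \<in> borel_measurable borel" by measurable
  have f_int: "integrable lborel (\<lambda>z. indicator gas_domain z * (f (snd z / fst z) * d_t \<phi> z))"
    using set_integrable_test_derivative(1)[OF \<phi> fm bound(1) gas_domain_borel]
    by (simp add: set_integrable_def)
  have g_int: "integrable lborel (\<lambda>z. indicator gas_domain z * (g (snd z / fst z) * d_x \<phi> z))"
    using set_integrable_test_derivative(2)[OF \<phi> gm bound(2) gas_domain_borel]
    by (simp add: set_integrable_def)
  have W1: "integrable (lborel \<Otimes>\<^sub>M lborel) (case_prod W1)"
    using Bochner_Integration.integrable_diff[OF f_int q_int]
    by (simp add: lborel_prod W1_def case_prod_beta' algebra_simps)
  have W2: "integrable (lborel \<Otimes>\<^sub>M lborel) (case_prod W2)"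
    using Bochner_Integration.integrable_add[OF g_int q_int]
    by (simp add: lborel_prod W2_def case_prod_beta' algebra_simps)

  have inner1: "(\<integral>t. W1 t x \<partial>lborel) = indicator {..<0} x * - (f0 * \<phi> (0, x))"
    if int: "integrable lborel (\<lambda>t. W1 t x)" for x
  proof (cases "x < 0")
    case True
    \<comment> \<open>At t = 0 the term f(x/t) would be f(0), as division by zero yields 0, and not
      the limit f0. For 0 < t <= e the ray x/t is at most 2 l0 < l0, where f is already f0;
      replacing t by max t e changes nothing for t > 0 and gives a function that is continuous down
      to t = 0.\<close>
    define e where "e = x / (2 * l0)"
    have e: "e > 0" using True l by (simp add: e_def zero_less_divide_iff)
    have xe: "x / e < l0" using True l by (simp add: e_def)
    define a where "a t = f (x / max t e)" for t
    have a_eq: "a t = f (x / t)" if "t > 0" for t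
    proof (cases "t < e")
      case True
      then have "x / t \<le> x / e" using that e \<open>x < 0\<close> by (intro divide_left_mono_neg) auto
      then show ?thesis using True xe by (simp add: a_def f0)
    qed (simp add: a_def)
    have a_cont: "continuous_on {0..T} a"
      unfolding a_def by (intro continuous_on_compose2[OF cont(1)] continuous_intros) (use e in auto)
    have der: "((\<lambda>s. a s * \<phi> (s, x)) has_vector_derivative W1 t x) (at t)"
      if t: "t \<in> {0<..<T} - {x / l0, x / l1}" for t
    proof -
      have "x / t \<notin> {l0, l1}" using t True by auto
      then have "((\<lambda>s. f (x / s)) has_real_derivative f' (x / t) * (- x / t\<^sup>2)) (at t)"
        using t by (intro DERIV_chain2[OF f']) (auto intro!: derivative_eq_intros simp: power2_eq_square)
      then have "(a has_real_derivative f' (x / t) * (- x / t\<^sup>2)) (at t)"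
        by (rule has_field_derivative_transform_within_open[where S="{0<..}"]) (use t a_eq in auto)
      from DERIV_mult[OF this test_function_DERIV(1)[OF \<phi>]] show ?thesis
        using t True a_eq[of t]
        by (simp add: has_real_derivative_iff_has_vector_derivative[symmetric] W1_def q_def
            gas_domain_def algebra_simps)
    qed
    have "continuous_on {0..T} (\<lambda>s. \<phi> (s, x))"
      by (rule continuous_on_compose2[OF \<phi>_cont]) (auto intro!: continuous_intros)
    then have "((\<lambda>t. W1 t x) has_integral a T * \<phi> (T, x) - a 0 * \<phi> (0, x)) {0..T}"
      using CT by (intro fundamental_theorem_of_calculus_interior_strong[of "{x / l0, x / l1}"]
          a_cont continuous_on_mult der) auto
    then have "((\<lambda>t. W1 t x) has_integral a T * \<phi> (T, x) - a 0 * \<phi> (0, x)) UNIV"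
    proof (rule has_integral_on_superset)
      show "W1 t x = 0" if "t \<notin> {0..T}" for t
        using that T[of t x] CT by (auto simp: W1_def q_def gas_domain_def indicator_def)
    qed simp
    moreover have "a 0 = f0" using e xe by (simp add: a_def f0)
    moreover have "\<phi> (T, x) = 0" using T[of T x] CT by simp
    ultimately have "((\<lambda>t. W1 t x) has_integral - (f0 * \<phi> (0, x))) UNIV"
      by simp
    from has_integral_unique[OF has_integral_integral_lborel[OF int] this] show ?thesis
      using True by simp
  next
    case False
    then have "W1 t x = 0" for t by (simp add: W1_def gas_domain_def)
    then show ?thesis using False by simp
  qed

  have inner2: "(\<integral>x. W2 t x \<partial>lborel) = 0"
    if int: "integrable lborel (\<lambda>x. W2 t x)" for t
  proof (cases "0 < t")
    case True
    have der: "((\<lambda>y. g (y / t) * \<phi> (t, y)) has_vector_derivative W2 t x) (at x)"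
      if x: "x \<in> {-T<..<0} - {l0 * t, l1 * t}" for x
    proof -
      have "x / t \<notin> {l0, l1}" using x True by auto
      then have "((\<lambda>y. g (y / t)) has_real_derivative x / t * f' (x / t) * (1 / t)) (at x)"
        using True by (intro DERIV_chain2[OF g']) (auto intro!: derivative_eq_intros)
      from DERIV_mult[OF this test_function_DERIV(2)[OF \<phi>]] show ?thesis
        using x True
        by (simp add: has_real_derivative_iff_has_vector_derivative[symmetric] W2_def q_def
            gas_domain_def algebra_simps power2_eq_square)
    qed
    have "continuous_on {-T..0} (\<lambda>y. \<phi> (t, y))"
      by (rule continuous_on_compose2[OF \<phi>_cont]) (auto intro!: continuous_intros)
    moreover have "continuous_on {-T..0} (\<lambda>y. g (y / t))"
      using True by (intro continuous_on_compose2[OF cont(2)] continuous_intros) auto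
    ultimately have "((\<lambda>x. W2 t x) has_integral g (0 / t) * \<phi> (t, 0) - g (- T / t) * \<phi> (t, - T)) {-T..0}"
      using CT by (intro fundamental_theorem_of_calculus_interior_strong[of "{l0 * t, l1 * t}"]
          continuous_on_mult der) auto
    then have "((\<lambda>x. W2 t x) has_integral g (0 / t) * \<phi> (t, 0) - g (- T / t) * \<phi> (t, - T)) UNIV"
    proof (rule has_integral_on_superset)
      show "W2 t x = 0" if "x \<notin> {-T..0}" for x
        using that T[of t x] CT by (auto simp: W2_def q_def gas_domain_def indicator_def)
    qed simp
    moreover have "\<phi> (t, - T) = 0" using T[of t "-T"] CT by simp
    \<comment> \<open>The end at -T lies outside the support, so the only boundary term left is the
      flux through the piston, which \<open>bdry\<close> removes.\<close>
    ultimately have "((\<lambda>x. W2 t x) has_integral 0) UNIV"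
      using bdry[of t] by simp
    from has_integral_unique[OF has_integral_integral_lborel[OF int] this] show ?thesis .
  next
    case False
    then have "W2 t x = 0" for x by (simp add: W2_def gas_domain_def)
    then show ?thesis by simp
  qed

  have "(LINT z:gas_domain|lborel. f (snd z / fst z) * d_t \<phi> z + g (snd z / fst z) * d_x \<phi> z)
      = (\<integral>z. case_prod W1 z + case_prod W2 z \<partial>(lborel \<Otimes>\<^sub>M lborel))"
    unfolding set_lebesgue_integral_def lborel_prod
    by (intro Bochner_Integration.integral_cong) (auto simp: W1_def W2_def algebra_simps)
  also have "\<dots> = (\<integral>z. case_prod W1 z \<partial>(lborel \<Otimes>\<^sub>M lborel)) + (\<integral>z. case_prod W2 z \<partial>(lborel \<Otimes>\<^sub>M lborel))"
    using W1 W2 by (rule Bochner_Integration.integral_add)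
  \<comment> \<open>Fubini is applied with opposite orders to the two halves: t inside for
    \<open>W1\<close>, which yields the initial data, and x inside for \<open>W2\<close>. Inner
    integrability holds only almost everywhere, which is enough.\<close>
  also have "(\<integral>z. case_prod W1 z \<partial>(lborel \<Otimes>\<^sub>M lborel)) = (\<integral>x. \<integral>t. W1 t x \<partial>lborel \<partial>lborel)"
    using W1 by (rule lborel_pair.integral_snd[symmetric])
  also have "\<dots> = (\<integral>x. indicator {..<0} x * - (f0 * \<phi> (0, x)) \<partial>lborel)"
  proof (rule integral_cong_AE)
    show "(\<lambda>x. \<integral>t. W1 t x \<partial>lborel) \<in> borel_measurable lborel"
      using lborel_pair.integrable_snd[OF W1] by blast
    show "(\<lambda>x. indicator {..<0} x * - (f0 * \<phi> (0, x))) \<in> borel_measurable lborel"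
      by measurable
    show "AE x in lborel. (\<integral>t. W1 t x \<partial>lborel) = indicator {..<0} x * - (f0 * \<phi> (0, x))"
      using lborel_pair.AE_integrable_snd[OF W1] by eventually_elim (rule inner1)
  qed
  also have "\<dots> = - (LINT x:{..<0}|lborel. f0 * \<phi> (0, x))"
    by (simp only: set_lebesgue_integral_def mult_minus_right real_scaleR_def
        Bochner_Integration.integral_minus)
  also have "(\<integral>z. case_prod W2 z \<partial>(lborel \<Otimes>\<^sub>M lborel)) = (\<integral>t. \<integral>x. W2 t x \<partial>lborel \<partial>lborel)"
    using W2 by (rule lborel_pair.integral_fst[symmetric])
  also have "\<dots> = (\<integral>t. 0 \<partial>(lborel :: real measure))"
  proof (rule integral_cong_AE)
    show "(\<lambda>t. \<integral>x. W2 t x \<partial>lborel) \<in> borel_measurable lborel"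
      using lborel_pair.integrable_fst[OF W2] by blast
    show "AE t in lborel. (\<integral>x. W2 t x \<partial>lborel) = 0"
      using lborel_pair.AE_integrable_fst[OF W2] by eventually_elim (rule inner2)
  qed simp
  finally show ?thesis by simp
qed

section \<open>Mass on the piston\<close>

text \<open>A cutoff supported in [-r, r]. The outer square makes it continuously differentiable at
  the ends, which is all that \<open>test_function\<close> asks for. It decreases strictly on
  [0, r], which provides the sign used on the piston.\<close>

definition bump :: "real \<Rightarrow> real \<Rightarrow> real" where
  "bump r s = (max 0 (r\<^sup>2 - s\<^sup>2))\<^sup>2"

lemma max_0_square_DERIV: "((\<lambda>y::real. (max 0 y)\<^sup>2) has_real_derivative 2 * max 0 y) (at y)"
proof -
  consider "y < 0" | "y = 0" | "0 < y" by linarith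
  then show ?thesis
  proof cases
    case 1
    show ?thesis
      by (rule has_field_derivative_transform_within_open[where f="\<lambda>_. 0" and S="{..<0}"])
        (use 1 in auto)
  next
    case 2
    \<comment> \<open>The difference quotient at 0 is max 0 h times a factor in [0, 1].\<close>
    have "((\<lambda>h::real. max 0 h * (max 0 h / h)) \<longlongrightarrow> 0) (at 0)"
    proof (rule tendsto_0_le[where K=1])
      show "((\<lambda>h::real. max 0 h) \<longlongrightarrow> 0) (at 0)"
        using tendsto_max[OF tendsto_const tendsto_ident_at, of "0::real" "0::real" UNIV] by simp
      show "\<forall>\<^sub>F h::real in at 0. norm (max 0 h * (max 0 h / h)) \<le> norm (max 0 h) * 1"
        by (rule always_eventually) (auto simp: max_def)
    qed
    then show ?thesis
      using 2 by (simp add: DERIV_def power2_eq_square)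
  next
    case 3
    show ?thesis
      by (rule has_field_derivative_transform_within_open[where f="\<lambda>y. y\<^sup>2" and S="{0<..}"])
        (use 3 in \<open>auto intro!: derivative_eq_intros\<close>)
  qed
qed

lemma bump_DERIV: "(bump r has_real_derivative - 4 * s * max 0 (r\<^sup>2 - s\<^sup>2)) (at s)"
proof -
  have "((\<lambda>s. r\<^sup>2 - s\<^sup>2) has_real_derivative - 2 * s) (at s)"
    by (auto intro!: derivative_eq_intros)
  from DERIV_chain2[OF max_0_square_DERIV this] show ?thesis
    unfolding bump_def[abs_def] by (simp add: mult_ac)
qed

lemma bump_continuous: "continuous_on UNIV (bump r)"
  unfolding bump_def[abs_def] by (intro continuous_intros)

lemma bump_eq_0: "0 \<le> r \<Longrightarrow> r \<le> \<bar>s\<bar> \<Longrightarrow> bump r s = 0"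
  using power_mono[of r "\<bar>s\<bar>" 2] by (simp add: bump_def)

lemma bump_product_DERIV:
  "((\<lambda>s. bump a s * bump b x) has_real_derivative - 4 * t * max 0 (a\<^sup>2 - t\<^sup>2) * bump b x) (at t)"
  "((\<lambda>y. bump a t * bump b y) has_real_derivative bump a t * (- 4 * x * max 0 (b\<^sup>2 - x\<^sup>2))) (at x)"
  by (intro DERIV_cmult_right DERIV_cmult bump_DERIV)+

lemma d_t_bump: "d_t (\<lambda>(t, x). bump a t * bump b x) = (\<lambda>(t, x). - 4 * t * max 0 (a\<^sup>2 - t\<^sup>2) * bump b x)"
proof (rule ext, clarify)
  show "d_t (\<lambda>(t, x). bump a t * bump b x) (t, x) = - 4 * t * max 0 (a\<^sup>2 - t\<^sup>2) * bump b x" for t x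
    unfolding d_t_def prod.case by (rule DERIV_imp_deriv, rule bump_product_DERIV)
qed

lemma d_x_bump: "d_x (\<lambda>(t, x). bump a t * bump b x) = (\<lambda>(t, x). bump a t * (- 4 * x * max 0 (b\<^sup>2 - x\<^sup>2)))"
proof (rule ext, clarify)
  show "d_x (\<lambda>(t, x). bump a t * bump b x) (t, x) = bump a t * (- 4 * x * max 0 (b\<^sup>2 - x\<^sup>2))" for t x
    unfolding d_x_def prod.case by (rule DERIV_imp_deriv, rule bump_product_DERIV)
qed

lemma test_function_bump:
  assumes "0 \<le> a" "0 \<le> b"
  shows "test_function (\<lambda>(t, x). bump a t * bump b x)"
  unfolding test_function_def d_t_bump d_x_bump
proof (intro conjI allI)
  show "(\<lambda>s. case (s, x) of (t, x) \<Rightarrow> bump a t * bump b x) differentiable at t" for t x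
    unfolding real_differentiable_def prod.case by (rule exI, rule bump_product_DERIV)
  show "(\<lambda>y. case (t, y) of (t, x) \<Rightarrow> bump a t * bump b x) differentiable at x" for t x
    unfolding real_differentiable_def prod.case by (rule exI, rule bump_product_DERIV)
  note [continuous_intros] = continuous_on_compose2[OF bump_continuous]
  show "continuous_on UNIV (\<lambda>(t, x). bump a t * bump b x)"
    unfolding case_prod_beta by (intro continuous_intros) auto
  show "continuous_on UNIV (\<lambda>(t, x). - 4 * t * max 0 (a\<^sup>2 - t\<^sup>2) * bump b x)"
    unfolding case_prod_beta by (intro continuous_intros) auto
  show "continuous_on UNIV (\<lambda>(t, x). bump a t * (- 4 * x * max 0 (b\<^sup>2 - x\<^sup>2)))"
    unfolding case_prod_beta by (intro continuous_intros) auto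
  have "{z. (case z of (t, x) \<Rightarrow> bump a t * bump b x) \<noteq> 0} \<subseteq> cbox (- a, - b) (a, b)"
  proof (clarsimp simp: cbox_Pair_eq)
    fix t x assume "bump a t \<noteq> 0" "bump b x \<noteq> 0"
    then have "\<bar>t\<bar> < a" "\<bar>x\<bar> < b" using bump_eq_0 assms by (meson not_le)+
    then show "- a \<le> t \<and> t \<le> a \<and> - b \<le> x \<and> x \<le> b" by linarith
  qed
  then show "compact (closure {z. (case z of (t, x) \<Rightarrow> bump a t * bump b x) \<noteq> 0})"
    using bounded_subset[OF bounded_cbox] compact_closure by blast
qed

lemma gas_piston_disjoint: "gas_domain \<inter> piston_path = {}"
  by (auto simp: gas_domain_def piston_path_def)

section \<open>What the weak formulation forces on an arbitrary solution\<close>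

context
  fixes A B \<alpha> v0 :: real and \<mu> :: "(real \<times> real) measure" and \<rho> u :: "real \<times> real \<Rightarrow> real"
  assumes sol: "piston_solution A B \<alpha> v0 \<mu> \<rho> u"
begin

lemma piston_solution_sets [measurable_cong, simp]: "sets \<mu> = sets borel"
  using sol by (simp add: piston_solution_def)

lemma piston_solution_pos: "z \<in> gas_domain \<union> piston_path \<Longrightarrow> \<rho> z > 0"
  using sol unfolding piston_solution_def by (elim conjE) (rule bspec)

text \<open>The density is positive on the piston path as well, so the boundary condition fixes the
  velocity itself. This reduces the mass integrand there to \<open>d_t \<phi>\<close> and later
  excludes the second family.\<close>

lemma piston_solution_piston: "z \<in> piston_path \<Longrightarrow> u z = 0"
proof -
  assume z: "z \<in> piston_path"
  have "\<forall>z \<in> piston_path. \<rho> z * u z = 0"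
    using sol unfolding piston_solution_def by (elim conjE)
  with z piston_solution_pos[of z] show "u z = 0" by force
qed

lemma piston_solution_emeasure:
  assumes "E \<in> sets borel" "E \<subseteq> gas_domain"
  shows "emeasure \<mu> E = (\<integral>\<^sup>+ z \<in> E. ennreal (\<rho> z) \<partial>lborel)"
proof -
  have "\<forall>E \<in> sets borel. E \<subseteq> gas_domain \<longrightarrow> emeasure \<mu> E = (\<integral>\<^sup>+ z \<in> E. ennreal (\<rho> z) \<partial>lborel)"
    using sol unfolding piston_solution_def by (elim conjE)
  with assms show ?thesis by blast
qed

text \<open>Measurability is assumed only on the closed domain; multiplying by the indicator gives
  functions on the whole plane to which the integration rules for densities apply.\<close>

lemma piston_solution_measurable [measurable]:
  "(\<lambda>z. indicator gas_domain z * \<rho> z) \<in> borel_measurable borel"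
  "(\<lambda>z. indicator gas_domain z * u z) \<in> borel_measurable borel"
proof -
  have *: "(\<lambda>z. indicator gas_domain z * w z) \<in> borel_measurable borel"
    if "w \<in> borel_measurable (restrict_space borel (gas_domain \<union> piston_path))" for w :: "real \<times> real \<Rightarrow> real"
  proof -
    have "(\<lambda>z. indicator (gas_domain \<union> piston_path) z *\<^sub>R w z) \<in> borel_measurable borel"
      using that by (subst (asm) borel_measurable_restrict_space_iff) auto
    then have "(\<lambda>z. indicator gas_domain z * (indicator (gas_domain \<union> piston_path) z *\<^sub>R w z)) \<in> borel_measurable borel"
      by measurable
    also have "(\<lambda>z. indicator gas_domain z * (indicator (gas_domain \<union> piston_path) z *\<^sub>R w z)) = (\<lambda>z. indicator gas_domain z * w z)"
      by (auto simp: indicator_def)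
    finally show ?thesis .
  qed
  have "\<rho> \<in> borel_measurable (restrict_space borel (gas_domain \<union> piston_path))"
    "u \<in> borel_measurable (restrict_space borel (gas_domain \<union> piston_path))"
    by (use sol in \<open>unfold piston_solution_def\<close>, elim conjE, assumption)+
  from this[THEN *] show "(\<lambda>z. indicator gas_domain z * \<rho> z) \<in> borel_measurable borel"
    "(\<lambda>z. indicator gas_domain z * u z) \<in> borel_measurable borel" .
qed

text \<open>The prescription of \<open>\<mu>\<close> on Borel subsets of the gas domain, recast as
  an equality of measures, so that integrals over the gas can be transferred to Lebesgue
  measure.\<close>

lemma piston_solution_density:
  "density \<mu> (indicator gas_domain) = density lborel (\<lambda>z. ennreal (indicator gas_domain z * \<rho> z))"
proof (rule measure_eqI)
  fix E assume "E \<in> sets (density \<mu> (indicator gas_domain))"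
  then have E[measurable]: "E \<in> sets borel" by simp
  have "emeasure (density \<mu> (indicator gas_domain)) E = emeasure \<mu> (gas_domain \<inter> E)"
    by (subst emeasure_density) (auto simp: indicator_inter_arith[symmetric])
  also have "\<dots> = (\<integral>\<^sup>+ z. ennreal (\<rho> z) * indicator (gas_domain \<inter> E) z \<partial>lborel)"
    by (rule piston_solution_emeasure) auto
  also have "\<dots> = (\<integral>\<^sup>+ z. ennreal (indicator gas_domain z * \<rho> z) * indicator E z \<partial>lborel)"
    by (rule nn_integral_cong) (auto simp: indicator_def)
  also have "\<dots> = emeasure (density lborel (\<lambda>z. ennreal (indicator gas_domain z * \<rho> z))) E"
    by (subst emeasure_density) auto
  finally show "emeasure (density \<mu> (indicator gas_domain)) E
      = emeasure (density lborel (\<lambda>z. ennreal (indicator gas_domain z * \<rho> z))) E" .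
qed simp

lemma piston_solution_set_integral_gas:
  assumes [measurable]: "(\<lambda>z. indicator gas_domain z * h z) \<in> borel_measurable borel"
  shows "(LINT z:gas_domain|\<mu>. h z) = (LINT z:gas_domain|lborel. \<rho> z * h z)"
proof -
  have nn: "0 \<le> indicator gas_domain z * \<rho> z" for z
    using piston_solution_pos[of z] by (auto simp: indicator_def)
  have "(LINT z:gas_domain|\<mu>. h z) = (\<integral>z. indicator gas_domain z *\<^sub>R (indicator gas_domain z * h z) \<partial>\<mu>)"
    unfolding set_lebesgue_integral_def
    by (rule Bochner_Integration.integral_cong) (auto simp: indicator_def)
  also have "\<dots> = (\<integral>z. indicator gas_domain z * h z \<partial>density \<mu> (\<lambda>z. ennreal (indicator gas_domain z)))"
    by (subst integral_density) auto
  also have "(\<lambda>z. ennreal (indicator gas_domain z)) = indicator gas_domain"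
    by (auto simp: indicator_def)
  also have "(\<integral>z. indicator gas_domain z * h z \<partial>density \<mu> (indicator gas_domain))
      = (\<integral>z. (indicator gas_domain z * \<rho> z) *\<^sub>R (indicator gas_domain z * h z) \<partial>lborel)"
    unfolding piston_solution_density by (subst integral_density) (auto simp: nn)
  also have "\<dots> = (LINT z:gas_domain|lborel. \<rho> z * h z)"
    unfolding set_lebesgue_integral_def
    by (rule Bochner_Integration.integral_cong) (auto simp: indicator_def)
  finally show ?thesis .
qed

text \<open>If the gas alone balances the mass, the mass on the piston annihilates all \<open>\<partial>\<phi>/\<partial>t\<close>. Testing
  with a function that decreases in time then shows that there is none.\<close>

lemma piston_solution_no_mass:
  assumes balance: "\<And>\<phi>. test_function \<phi> \<Longrightarrow>
      (LINT z:gas_domain|lborel. \<rho> z * (d_t \<phi> z + u z * d_x \<phi> z)) + (LINT x:{..<0}|lborel. \<phi> (0, x)) = 0"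
  shows "emeasure \<mu> piston_path = 0"
proof -
  have AE: "AE z in \<mu>. z \<in> piston_path \<longrightarrow> real n \<le> fst z" for n
  proof -
    \<comment> \<open>On x = 0 the second factor is 1, and the time derivative of the first is -4 t
      (n^2 - t^2) for 0 < t < n, strictly negative, and 0 from t = n on.\<close>
    define \<phi> where "\<phi> = (\<lambda>(t, x). bump (real n) t * bump 1 x)"
    define k where "k z = d_t \<phi> z + u z * d_x \<phi> z" for z
    have \<phi>: "test_function \<phi>" unfolding \<phi>_def by (rule test_function_bump) auto
    have "\<forall>\<phi>. test_function \<phi> \<longrightarrow>
        set_integrable \<mu> (gas_domain \<union> piston_path) (\<lambda>z. d_t \<phi> z + u z * d_x \<phi> z) \<and>
        (LINT z:gas_domain \<union> piston_path|\<mu>. d_t \<phi> z + u z * d_x \<phi> z)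
          + (LINT x:{..<0}|lborel. \<phi> (0, x)) = 0"
      using sol unfolding piston_solution_def by (elim conjE)
    with \<phi> have int: "set_integrable \<mu> (gas_domain \<union> piston_path) k"
      and eq: "(LINT z:gas_domain \<union> piston_path|\<mu>. k z) + (LINT x:{..<0}|lborel. \<phi> (0, x)) = 0"
      unfolding k_def by blast+
    have int_gas: "set_integrable \<mu> gas_domain k" and int_piston: "set_integrable \<mu> piston_path k"
      using set_integrable_subset[OF int] by auto
    note [measurable] = borel_measurable_test_function[OF \<phi>]
    have "(\<lambda>z. indicator gas_domain z * d_t \<phi> z + (indicator gas_domain z * u z) * d_x \<phi> z) \<in> borel_measurable borel"
      by measurable
    then have "(\<lambda>z. indicator gas_domain z * k z) \<in> borel_measurable borel"
      by (simp add: k_def algebra_simps)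
    from piston_solution_set_integral_gas[OF this] balance[OF \<phi>]
    have "(LINT z:gas_domain|\<mu>. k z) + (LINT x:{..<0}|lborel. \<phi> (0, x)) = 0"
      by (simp only: k_def)
    moreover have "(LINT z:gas_domain \<union> piston_path|\<mu>. k z)
        = (LINT z:gas_domain|\<mu>. k z) + (LINT z:piston_path|\<mu>. k z)"
      by (rule set_integral_Un[OF gas_piston_disjoint int_gas int_piston])
    \<comment> \<open>Subtracting the balance of the gas from that of \<open>\<mu>\<close> cancels
      the initial data and leaves only the integral over the piston. Its integrand has one sign, so
      it vanishes almost everywhere, which excludes mass at times before n.\<close>
    ultimately have zero: "(\<integral>z. - (indicator piston_path z * k z) \<partial>\<mu>) = 0"
      using eq by (simp add: set_lebesgue_integral_def)
    have bump_1_0: "bump 1 0 = 1" by (simp add: bump_def)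
    have k: "k z = - 4 * fst z * max 0 ((real n)\<^sup>2 - (fst z)\<^sup>2)" if "z \<in> piston_path" for z
      using piston_solution_piston[OF that] that
      by (auto simp: k_def \<phi>_def d_t_bump piston_path_def bump_1_0)
    have nonneg: "0 \<le> - (indicator piston_path z * k z)" for z
      using k[of z] by (auto simp: indicator_def piston_path_def)
    have "integrable \<mu> (\<lambda>z. - (indicator piston_path z * k z))"
      using int_piston by (simp add: set_integrable_def)
    from integral_nonneg_eq_0_iff_AE[OF this] nonneg zero
    have "AE z in \<mu>. - (indicator piston_path z * k z) = 0" by simp
    then show ?thesis
    proof eventually_elim
      case (elim z)
      show ?case
      proof
        assume z: "z \<in> piston_path"
        then have "fst z > 0" by (auto simp: piston_path_def)
        with elim k[OF z] z have "(real n)\<^sup>2 \<le> (fst z)\<^sup>2"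
          by (auto simp: max_def split: if_splits)
        with \<open>fst z > 0\<close> show "real n \<le> fst z"
          by (simp add: power2_le_iff_abs_le)
      qed
    qed
  qed
  \<comment> \<open>Countably many exceptional sets are joined; no time exceeds every n.\<close>
  then have "AE z in \<mu>. \<forall>n. z \<in> piston_path \<longrightarrow> real n \<le> fst z"
    by (intro iffD2[OF AE_all_countable] allI)
  then have "AE z in \<mu>. z \<notin> piston_path"
    by eventually_elim (meson not_le reals_Archimedean2)
  moreover have "{z \<in> space \<mu>. \<not> z \<notin> piston_path} = piston_path"
    using sets_eq_imp_space_eq[OF piston_solution_sets] by auto
  ultimately show ?thesis
    using AE_iff_measurable[of piston_path \<mu> "\<lambda>z. z \<notin> piston_path"] by simp
qed

lemma piston_solution_emeasure_no_mass:
  assumes "emeasure \<mu> piston_path = 0" and [measurable]: "E \<in> sets borel"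
  shows "emeasure \<mu> E = (\<integral>\<^sup>+ z \<in> E \<inter> gas_domain. ennreal (\<rho> z) \<partial>lborel)"
proof -
  have "emeasure \<mu> (- (gas_domain \<union> piston_path)) = 0"
    using sol unfolding piston_solution_def by (elim conjE)
  then have "piston_path \<union> - (gas_domain \<union> piston_path) \<in> null_sets \<mu>"
    using assms by (intro null_sets.Un null_setsI) auto
  then have "emeasure \<mu> E = emeasure \<mu> (E - (piston_path \<union> - (gas_domain \<union> piston_path)))"
    by (intro emeasure_Diff_null_set[symmetric]) auto
  also have "E - (piston_path \<union> - (gas_domain \<union> piston_path)) = E \<inter> gas_domain"
    using gas_piston_disjoint by auto
  finally show ?thesis by (simp add: piston_solution_emeasure)
qed

end

text \<open>Outside the closed domain the measure is null by definition. Once the piston is a null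
  set too, the density in the gas determines the value on every Borel set.\<close>

lemma piston_solution_measure_unique:
  assumes "piston_solution A B \<alpha> v0 \<mu> \<rho> u" "emeasure \<mu> piston_path = 0"
    and "piston_solution A B \<alpha> v0 \<mu>' \<rho>' u'" "emeasure \<mu>' piston_path = 0"
    and "\<And>z. z \<in> gas_domain \<Longrightarrow> \<rho> z = \<rho>' z"
  shows "\<mu> = \<mu>'"
proof (rule measure_eqI)
  show "sets \<mu> = sets \<mu>'"
    using assms by (simp add: piston_solution_sets)
  fix E assume "E \<in> sets \<mu>"
  then have E: "E \<in> sets borel" using piston_solution_sets[OF assms(1)] by simp
  have "(\<integral>\<^sup>+ z \<in> E \<inter> gas_domain. ennreal (\<rho> z) \<partial>lborel) = (\<integral>\<^sup>+ z \<in> E \<inter> gas_domain. ennreal (\<rho>' z) \<partial>lborel)"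
    by (rule nn_integral_cong) (auto simp: indicator_def assms(5))
  then show "emeasure \<mu> E = emeasure \<mu>' E"
    using piston_solution_emeasure_no_mass[OF assms(1,2) E] piston_solution_emeasure_no_mass[OF assms(3,4) E]
    by simp
qed

section \<open>The rarefaction wave of the first family\<close>

locale modified_chaplygin_gas =
  fixes A B \<alpha> :: real
  assumes \<alpha>: "0 < \<alpha>" "\<alpha> < 1" and A: "0 < A" and B: "0 < B"
begin

definition sound :: "real \<Rightarrow> real" where
  "sound \<rho> = sqrt (A + B * \<alpha> / \<rho> powr (\<alpha> + 1))"

text \<open>An antiderivative of c/\<rho>. From c^2 - A = B \<alpha> / \<rho>^(\<alpha>+1) follows
  d\<rho>/\<rho> = - 2 c dc / ((\<alpha>+1)(c^2 - A)), so the integral becomes -2/(\<alpha>+1) times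
  that of c^2/(c^2 - A) = 1 + A/(c^2 - A); the logarithm integrates the last term.\<close>

definition riemann :: "real \<Rightarrow> real" where
  "riemann \<rho> = - (2 / (\<alpha> + 1)) *
     (sound \<rho> + sqrt A / 2 * ln ((sound \<rho> - sqrt A) / (sound \<rho> + sqrt A)))"

lemma eigenvalue_1: "eigenvalue A B \<alpha> 1 z = snd z - sound (fst z)"
  and eigenvalue_2: "eigenvalue A B \<alpha> 2 z = snd z + sound (fst z)"
  by (simp_all add: eigenvalue_def sound_def case_prod_beta)

lemma sound_sq: "(sound \<rho>)\<^sup>2 = A + B * \<alpha> / \<rho> powr (\<alpha> + 1)"
  unfolding sound_def using \<alpha> A B by (intro real_sqrt_pow2) (auto intro!: add_nonneg_nonneg)

lemma sound_gt: "\<rho> > 0 \<Longrightarrow> sound \<rho> > sqrt A"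
  unfolding sound_def using \<alpha> B by simp

lemma sound_pos: "sound \<rho> > 0"
  unfolding sound_def using \<alpha> A B by (auto intro!: add_pos_nonneg)

lemma pressure_DERIV:
  assumes "\<rho> > 0"
  shows "(pressure A B \<alpha> has_real_derivative (sound \<rho>)\<^sup>2) (at \<rho>)"
proof -
  have "((\<lambda>r. A * r - B * r powr (-\<alpha>)) has_real_derivative
          A - B * (-\<alpha> * \<rho> powr (-\<alpha> - 1))) (at \<rho>)"
    using assms by (auto intro!: derivative_eq_intros)
  moreover have "pressure A B \<alpha> = (\<lambda>r. A * r - B * r powr (-\<alpha>))"
    by (auto simp: pressure_def powr_minus field_simps)
  moreover have "A - B * (-\<alpha> * \<rho> powr (-\<alpha> - 1)) = (sound \<rho>)\<^sup>2"
    using powr_minus_divide[of \<rho> "\<alpha> + 1"] by (simp add: minus_diff_commute sound_sq)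
  ultimately show ?thesis by simp
qed

text \<open>Obtained from 2 c c' = -(\<alpha>+1)(c^2 - A)/\<rho>. Expressing the power of \<rho>
  through c^2 - A makes all later identities rational in c and \<rho>.\<close>

lemma sound_DERIV:
  assumes "\<rho> > 0"
  shows "(sound has_real_derivative - ((\<alpha> + 1) * ((sound \<rho>)\<^sup>2 - A) / (2 * sound \<rho> * \<rho>))) (at \<rho>)"
proof -
  have eq: "sound = (\<lambda>r. sqrt (A + B * \<alpha> * r powr (- (\<alpha> + 1))))"
    by (auto simp: sound_def powr_minus field_simps simp del: minus_add_distrib)
  have pos: "A + B * \<alpha> * \<rho> powr (- (\<alpha> + 1)) > 0"
    using \<alpha> A B by (auto intro!: add_pos_nonneg)
  define p where "p = \<rho> powr (- (\<alpha> + 1))"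
  have sq: "(sound \<rho>)\<^sup>2 - A = B * \<alpha> * p"
    using powr_minus_divide[of \<rho> "\<alpha> + 1"] by (simp add: sound_sq p_def)
  have "((\<lambda>r. A + B * \<alpha> * r powr (- (\<alpha> + 1))) has_real_derivative
      B * \<alpha> * (- (\<alpha> + 1) * \<rho> powr (- (\<alpha> + 1) - 1))) (at \<rho>)"
    using assms by (auto intro!: derivative_eq_intros)
  from DERIV_chain2[OF DERIV_real_sqrt[OF pos] this]
  have "(sound has_real_derivative inverse (sound \<rho>) / 2 *
      (B * \<alpha> * (- (\<alpha> + 1) * \<rho> powr (- (\<alpha> + 1) - 1)))) (at \<rho>)"
    by (simp only: eq)
  moreover have pd: "\<rho> powr (- (\<alpha> + 1) - 1) = p / \<rho>"
    unfolding p_def using assms by (subst powr_diff) simp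
  have "inverse (sound \<rho>) / 2 * (B * \<alpha> * (- (\<alpha> + 1) * \<rho> powr (- (\<alpha> + 1) - 1)))
      = - ((\<alpha> + 1) * ((sound \<rho>)\<^sup>2 - A) / (2 * sound \<rho> * \<rho>))"
    unfolding sq pd using assms sound_pos[of \<rho>] by (simp add: field_simps)
  ultimately show ?thesis by (simp only:)
qed

lemma riemann_DERIV:
  assumes "\<rho> > 0"
  shows "(riemann has_real_derivative sound \<rho> / \<rho>) (at \<rho>)"
proof -
  define c where "c = sound \<rho>"
  define r where "r = sqrt A"
  define c' where "c' = - ((\<alpha> + 1) * (c\<^sup>2 - A) / (2 * c * \<rho>))"
  have r: "r > 0" "r < c" "A = r\<^sup>2"
    using A sound_gt[OF assms] by (simp_all add: r_def c_def)
  have D: "(sound has_real_derivative c') (at \<rho>)"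
    using sound_DERIV[OF assms] by (simp add: c'_def c_def)
  have L: "((\<lambda>x. ln ((sound x - r) / (sound x + r))) has_real_derivative
      c' / (c - r) - c' / (c + r)) (at \<rho>)"
  proof -
    have "((\<lambda>x. (sound x - r) / (sound x + r)) has_real_derivative
        (c' * (c + r) - (c - r) * c') / ((c + r) * (c + r))) (at \<rho>)"
      using r D by (auto intro!: derivative_eq_intros simp: c_def)
    from DERIV_chain2[OF DERIV_ln this]
    have "((\<lambda>x. ln ((sound x - r) / (sound x + r))) has_real_derivative
       inverse ((c - r) / (c + r)) * ((c' * (c + r) - (c - r) * c') / ((c + r) * (c + r)))) (at \<rho>)"
      using r by (simp add: c_def)
    moreover have "inverse ((c - r) / (c + r)) * ((c' * (c + r) - (c - r) * c') / ((c + r) * (c + r)))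
       = c' / (c - r) - c' / (c + r)"
    proof -
      have "c - r \<noteq> 0" "c + r \<noteq> 0" using r by auto
      then show ?thesis by (simp add: divide_simps)
    qed
    ultimately show ?thesis by simp
  qed
  have "(riemann has_real_derivative
      - (2 / (\<alpha> + 1)) * (c' + r / 2 * (c' / (c - r) - c' / (c + r)))) (at \<rho>)"
    unfolding riemann_def r_def[symmetric]
    by (intro DERIV_cmult DERIV_add D L)
  moreover have "- (2 / (\<alpha> + 1)) * (c' + r / 2 * (c' / (c - r) - c' / (c + r))) = c / \<rho>"
  proof -
    have nz: "c - r \<noteq> 0" "c + r \<noteq> 0" "c \<noteq> 0" "\<alpha> + 1 \<noteq> 0" using r \<alpha> by auto
    \<comment> \<open>Partial fractions read backwards: the sum collapses to c' c^2/(c^2 - A), and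
      c' carries the factor c^2 - A that cancels the denominator.\<close>
    have "c' / (c - r) - c' / (c + r) = c' * (2 * r) / ((c - r) * (c + r))"
      using nz by (simp add: divide_simps algebra_simps)
    also have "(c - r) * (c + r) = c\<^sup>2 - A"
      by (simp add: r algebra_simps power2_eq_square)
    finally have 1: "c' + r / 2 * (c' / (c - r) - c' / (c + r)) = c' * (1 + A / (c\<^sup>2 - A))"
      by (simp add: r power2_eq_square algebra_simps)
    have nz2: "c\<^sup>2 - A \<noteq> 0" using r by (simp add: power2_eq_iff)
    then have 2: "1 + A / (c\<^sup>2 - A) = c\<^sup>2 / (c\<^sup>2 - A)"
      by (simp add: divide_simps)
    show ?thesis
      unfolding 1 unfolding 2 unfolding c'_def using nz nz2 assms by (simp add: divide_simps power2_eq_square)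
  qed
  ultimately show ?thesis by (simp add: c_def)
qed

lemma riemann_strict_mono:
  assumes "0 < a" "a < b"
  shows "riemann a < riemann b"
proof (rule DERIV_pos_imp_increasing[OF assms(2)])
  fix x assume "a \<le> x" "x \<le> b"
  then show "\<exists>y. (riemann has_real_derivative y) (at x) \<and> 0 < y"
    using assms riemann_DERIV[of x] sound_pos[of x] by (intro exI[of _ "sound x / x"]) auto
qed

lemma riemann_mono: "0 < a \<Longrightarrow> a \<le> b \<Longrightarrow> riemann a \<le> riemann b"
  using riemann_strict_mono[of a b] by (cases "a = b") auto

lemma riemann_inj: "0 < a \<Longrightarrow> 0 < b \<Longrightarrow> riemann a = riemann b \<Longrightarrow> a = b"
  using riemann_strict_mono[of a b] riemann_strict_mono[of b a] by fastforce

text \<open>Since \<open>sound \<rho> > sqrt A\<close>, the Riemann invariant dominates \<open>sqrt A * ln \<rho>\<close> and is unbounded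
  below, so every piston speed is reached.\<close>

lemma riemann_ln:
  assumes "0 < e" "e < 1"
  shows "riemann e - riemann 1 < sqrt A * ln e"
proof -
  have "riemann e - sqrt A * ln e < riemann 1 - sqrt A * ln 1"
  proof (rule DERIV_pos_imp_increasing[OF assms(2)])
    fix x assume x: "e \<le> x" "x \<le> 1"
    then have "((\<lambda>x. riemann x - sqrt A * ln x) has_real_derivative sound x / x - sqrt A * (1 / x)) (at x)"
      using assms by (intro DERIV_diff riemann_DERIV DERIV_cmult DERIV_ln_divide) auto
    moreover have "0 < sound x / x - sqrt A * (1 / x)"
      using sound_gt[of x] x assms by (simp add: divide_strict_right_mono)
    ultimately show "\<exists>y. ((\<lambda>x. riemann x - sqrt A * ln x) has_real_derivative y) (at x) \<and> 0 < y"
      by blast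
  qed
  then show ?thesis by simp
qed

lemma riemann_continuous: "continuous_on {0<..} riemann"
  using riemann_DERIV by (auto intro!: continuous_at_imp_continuous_on dest: DERIV_isCont)

lemma sound_continuous: "continuous_on {0<..} sound"
  using sound_DERIV by (auto intro!: continuous_at_imp_continuous_on dest: DERIV_isCont)

end

section \<open>The wave curve through the initial state and its inversion\<close>

locale receding_piston = modified_chaplygin_gas +
  fixes v0 :: real
  assumes v0: "0 < v0"
begin

definition \<rho>1 :: real where
  "\<rho>1 = (THE \<rho>. 0 < \<rho> \<and> riemann \<rho> = riemann 1 - v0)"

lemma \<rho>1_unique:
  assumes "0 < \<rho>" "riemann \<rho> = riemann 1 - v0"
  shows "\<rho> = \<rho>1"
  unfolding \<rho>1_def using assms by (intro the_equality[symmetric]) (auto intro: riemann_inj)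

lemma \<rho>1_props: "0 < \<rho>1" "\<rho>1 < 1" "riemann \<rho>1 = riemann 1 - v0"
proof -
  \<comment> \<open>Chosen so that sqrt A * ln e = - v0: the logarithmic bound then places
    \<open>riemann e\<close> below the target value, and e is a lower end for the intermediate value
    theorem.\<close>
  define e where "e = exp (- v0 / sqrt A)"
  have e: "0 < e" "e < 1" using v0 A by (simp_all add: e_def)
  have "sqrt A * ln e = - v0" using A by (simp add: e_def)
  with riemann_ln[OF e] have "riemann e \<le> riemann 1 - v0" by simp
  moreover have "continuous_on {e..1} riemann"
    by (rule continuous_on_subset[OF riemann_continuous]) (use e in auto)
  ultimately obtain \<rho> where \<rho>: "e \<le> \<rho>" "\<rho> \<le> 1" "riemann \<rho> = riemann 1 - v0"
    using IVT'[of riemann e "riemann 1 - v0" 1] e v0 by auto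
  then have "\<rho> = \<rho>1" using e by (intro \<rho>1_unique) auto
  moreover have "\<rho> \<noteq> 1" using \<rho> v0 by auto
  ultimately show "0 < \<rho>1" "\<rho>1 < 1" "riemann \<rho>1 = riemann 1 - v0"
    using \<rho> e by auto
qed

text \<open>The first eigenvalue along the integral curve of the first family through \<open>(1, - v0)\<close>,
  and its derivative, whose sign is where \<open>\<alpha> < 1\<close> enters.\<close>

definition \<Lambda> :: "real \<Rightarrow> real" where
  "\<Lambda> \<rho> = riemann 1 - v0 - riemann \<rho> - sound \<rho>"

definition \<Lambda>' :: "real \<Rightarrow> real" where
  "\<Lambda>' \<rho> = - (((1 - \<alpha>) * (sound \<rho>)\<^sup>2 + (1 + \<alpha>) * A) / (2 * sound \<rho> * \<rho>))"

text \<open>The two contributions combine through 2 c^2 - (\<alpha>+1)(c^2 - A) = (1-\<alpha>) c^2 +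
  (1+\<alpha>) A. A fixed sign of this derivative is genuine nonlinearity of the first
  family.\<close>

lemma \<Lambda>_DERIV:
  assumes "\<rho> > 0"
  shows "(\<Lambda> has_real_derivative \<Lambda>' \<rho>) (at \<rho>)"
proof -
  have "(\<Lambda> has_real_derivative 0 - sound \<rho> / \<rho> - - ((\<alpha> + 1) * ((sound \<rho>)\<^sup>2 - A) / (2 * sound \<rho> * \<rho>))) (at \<rho>)"
    unfolding \<Lambda>_def
    by (intro DERIV_diff DERIV_const riemann_DERIV sound_DERIV assms)
  moreover have "0 - sound \<rho> / \<rho> - - ((\<alpha> + 1) * ((sound \<rho>)\<^sup>2 - A) / (2 * sound \<rho> * \<rho>)) = \<Lambda>' \<rho>"
    unfolding \<Lambda>'_def using assms sound_pos[of \<rho>]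
    by (simp add: divide_simps power2_eq_square algebra_simps)
  ultimately show ?thesis by simp
qed

lemma \<Lambda>'_neg: "\<rho> > 0 \<Longrightarrow> \<Lambda>' \<rho> < 0"
  unfolding \<Lambda>'_def using \<alpha> A sound_pos[of \<rho>]
  by (auto intro!: divide_pos_pos add_nonneg_pos mult_nonneg_nonneg)

lemma \<Lambda>_strict_antimono:
  assumes "0 < a" "a < b"
  shows "\<Lambda> b < \<Lambda> a"
  by (rule DERIV_neg_imp_decreasing[OF assms(2)])
    (use assms \<Lambda>_DERIV \<Lambda>'_neg in \<open>meson less_le_trans\<close>)

lemma \<Lambda>_inj: "0 < a \<Longrightarrow> 0 < b \<Longrightarrow> \<Lambda> a = \<Lambda> b \<Longrightarrow> a = b"
  using \<Lambda>_strict_antimono[of a b] \<Lambda>_strict_antimono[of b a] by fastforce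

definition l0 :: real where "l0 = - v0 - sound 1"
definition l1 :: real where "l1 = - sound \<rho>1"

lemma \<Lambda>_ends: "\<Lambda> 1 = l0" "\<Lambda> \<rho>1 = l1"
  using \<rho>1_props by (simp_all add: \<Lambda>_def l0_def l1_def)

lemma speeds_ordered: "l0 < l1" "l1 < 0"
  using \<Lambda>_strict_antimono[of \<rho>1 1] \<rho>1_props sound_pos[of \<rho>1] by (simp_all add: \<Lambda>_ends l1_def)

text \<open>Clamping the similarity variable to the fan gives both constant states and the wave by a
  single formula, so continuity on the whole line follows from that of the inverse on a compact
  interval.\<close>

definition clip :: "real \<Rightarrow> real" where
  "clip \<xi> = max l0 (min l1 \<xi>)"

definition R :: "real \<Rightarrow> real" where
  "R \<xi> = inv_into {\<rho>1..1} \<Lambda> (clip \<xi>)"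

definition U :: "real \<Rightarrow> real" where
  "U \<xi> = riemann 1 - v0 - riemann (R \<xi>)"

lemma \<Lambda>_continuous: "continuous_on {\<rho>1..1} \<Lambda>"
  by (intro continuous_at_imp_continuous_on ballI DERIV_isCont[OF \<Lambda>_DERIV]) (use \<rho>1_props in auto)

lemma \<Lambda>_inj_on: "inj_on \<Lambda> {\<rho>1..1}"
  using \<rho>1_props by (auto intro!: inj_onI \<Lambda>_inj)

lemma \<Lambda>_image: "\<Lambda> ` {\<rho>1..1} = {l0..l1}"
proof (intro equalityI subsetI)
  fix y assume "y \<in> \<Lambda> ` {\<rho>1..1}"
  then obtain \<rho> where \<rho>: "\<rho>1 \<le> \<rho>" "\<rho> \<le> 1" "y = \<Lambda> \<rho>" by auto
  then show "y \<in> {l0..l1}"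
    using \<Lambda>_strict_antimono[of \<rho>1 \<rho>] \<Lambda>_strict_antimono[of \<rho> 1] \<rho>1_props \<Lambda>_ends
    by (cases "\<rho> = 1"; cases "\<rho> = \<rho>1") auto
next
  fix y assume "y \<in> {l0..l1}"
  then show "y \<in> \<Lambda> ` {\<rho>1..1}"
    using IVT2'[of \<Lambda> 1 y \<rho>1] \<rho>1_props \<Lambda>_ends \<Lambda>_continuous by auto
qed

lemma clip_in: "clip \<xi> \<in> {l0..l1}"
  using speeds_ordered by (auto simp: clip_def)

lemma R_inverse: "R \<xi> \<in> {\<rho>1..1}" "\<Lambda> (R \<xi>) = clip \<xi>"
  unfolding R_def using clip_in[of \<xi>] \<Lambda>_image
  by (metis inv_into_into, metis f_inv_into_f)

lemma R_pos: "R \<xi> > 0"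
  using R_inverse(1)[of \<xi>] \<rho>1_props by auto

lemma R_eqI: "0 < \<rho> \<Longrightarrow> \<Lambda> \<rho> = clip \<xi> \<Longrightarrow> R \<xi> = \<rho>"
  using R_inverse[of \<xi>] R_pos \<Lambda>_inj by metis

lemma R_left: "\<xi> \<le> l0 \<Longrightarrow> R \<xi> = 1"
  using speeds_ordered by (intro R_eqI) (auto simp: clip_def \<Lambda>_ends)

lemma R_right: "l1 \<le> \<xi> \<Longrightarrow> R \<xi> = \<rho>1"
  using speeds_ordered \<rho>1_props by (intro R_eqI) (auto simp: clip_def \<Lambda>_ends)

lemma U_left: "\<xi> \<le> l0 \<Longrightarrow> U \<xi> = - v0"
  by (simp add: U_def R_left)

lemma U_right: "l1 \<le> \<xi> \<Longrightarrow> U \<xi> = 0"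
  by (simp add: U_def R_right \<rho>1_props)

lemma U_bounds: "- v0 \<le> U \<xi>" "U \<xi> \<le> 0"
  using riemann_mono[of "R \<xi>" 1] riemann_mono[of \<rho>1 "R \<xi>"] R_inverse(1)[of \<xi>] R_pos[of \<xi>] \<rho>1_props
  by (auto simp: U_def)

lemma U_minus_sound: "U \<xi> - sound (R \<xi>) = clip \<xi>"
  using R_inverse(2)[of \<xi>] by (simp add: U_def \<Lambda>_def)

lemma R_continuous: "continuous_on UNIV R"
proof -
  have "continuous_on (\<Lambda> ` {\<rho>1..1}) (inv_into {\<rho>1..1} \<Lambda>)"
    by (rule continuous_on_inv) (auto simp: \<Lambda>_continuous \<Lambda>_inj_on)
  then have "continuous_on {l0..l1} (inv_into {\<rho>1..1} \<Lambda>)"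
    by (simp add: \<Lambda>_image)
  then have "continuous_on UNIV (\<lambda>\<xi>. inv_into {\<rho>1..1} \<Lambda> (clip \<xi>))"
    by (rule continuous_on_compose2) (use clip_in in \<open>auto simp: clip_def intro!: continuous_intros\<close>)
  then show ?thesis by (simp add: R_def[abs_def])
qed

lemma U_continuous: "continuous_on UNIV U"
  unfolding U_def
  by (intro continuous_intros continuous_on_compose2[OF riemann_continuous R_continuous])
    (use R_pos in auto)

text \<open>The derivative of \<open>R\<close> away from the kinks at l0 and l1. There the value 0
  is a convention; it keeps the function bounded, measurable and zero outside the fan, as
  \<open>self_similar_balance\<close> requires.\<close>

definition R' :: "real \<Rightarrow> real" where
  "R' \<xi> = indicator {l0<..<l1} \<xi> * inverse (\<Lambda>' (R \<xi>))"

lemma inverse_\<Lambda>'_continuous: "continuous_on {\<rho>1..1} (\<lambda>\<rho>. inverse (\<Lambda>' \<rho>))"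
proof -
  have "continuous_on {\<rho>1..1} sound"
    by (rule continuous_on_subset[OF sound_continuous]) (use \<rho>1_props in auto)
  moreover have "sound \<rho> \<noteq> 0" for \<rho> using sound_pos[of \<rho>] by simp
  ultimately have "continuous_on {\<rho>1..1} \<Lambda>'"
    unfolding \<Lambda>'_def using \<rho>1_props by (intro continuous_intros) auto
  moreover have "\<Lambda>' \<rho> \<noteq> 0" if "\<rho> \<in> {\<rho>1..1}" for \<rho>
    using \<Lambda>'_neg[of \<rho>] \<rho>1_props that by auto
  ultimately show ?thesis
    by (intro continuous_on_inverse) auto
qed

lemma inverse_\<Lambda>'_R_continuous: "continuous_on UNIV (\<lambda>\<xi>. inverse (\<Lambda>' (R \<xi>)))"
  by (rule continuous_on_compose2[OF inverse_\<Lambda>'_continuous R_continuous]) (use R_inverse in auto)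

lemma R'_measurable: "R' \<in> borel_measurable borel"
proof -
  note [measurable] = borel_measurable_continuous_onI[OF inverse_\<Lambda>'_R_continuous]
  show ?thesis unfolding R'_def[abs_def] by measurable
qed

lemma R'_bounded: "\<exists>K. \<forall>\<xi>. \<bar>R' \<xi>\<bar> \<le> K"
proof -
  have "bounded ((\<lambda>\<rho>. inverse (\<Lambda>' \<rho>)) ` {\<rho>1..1})"
    using compact_continuous_image[OF inverse_\<Lambda>'_continuous compact_Icc] compact_imp_bounded by blast
  then obtain K where K: "K > 0" "\<forall>y\<in>(\<lambda>\<rho>. inverse (\<Lambda>' \<rho>)) ` {\<rho>1..1}. norm y \<le> K"
    using bounded_pos by blast
  then have "\<bar>inverse (\<Lambda>' (R \<xi>))\<bar> \<le> K" for \<xi>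
    using R_inverse(1)[of \<xi>] by auto
  then have "\<bar>R' \<xi>\<bar> \<le> K" for \<xi>
    using K(1) by (simp add: R'_def indicator_def)
  then show ?thesis by blast
qed

lemma R_DERIV:
  assumes "\<xi> \<notin> {l0, l1}"
  shows "(R has_real_derivative R' \<xi>) (at \<xi>)"
proof -
  consider "\<xi> < l0" | "l0 < \<xi>" "\<xi> < l1" | "l1 < \<xi>"
    using assms by (simp, linarith)
  then show ?thesis
  proof cases
    case 1
    show ?thesis
      by (rule has_field_derivative_transform_within_open[where f="\<lambda>_. 1" and S="{..<l0}"])
        (use 1 speeds_ordered in \<open>auto simp: R'_def R_left\<close>)
  next
    case 2
    have "(R has_real_derivative inverse (\<Lambda>' (R \<xi>))) (at \<xi>)"
    proof (rule DERIV_inverse_function[where f=\<Lambda> and a=l0 and b=l1])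
      show "(\<Lambda> has_real_derivative \<Lambda>' (R \<xi>)) (at (R \<xi>))" using R_pos by (rule \<Lambda>_DERIV)
      show "\<Lambda>' (R \<xi>) \<noteq> 0" using \<Lambda>'_neg[OF R_pos, of \<xi>] by simp
      show "isCont R \<xi>" using R_continuous by (simp add: continuous_on_eq_continuous_at)
      show "l0 < \<xi>" "\<xi> < l1" by fact+
      show "\<Lambda> (R y) = y" if "l0 < y" "y < l1" for y using that by (simp add: R_inverse(2) clip_def)
    qed
    then show ?thesis using 2 by (simp add: R'_def)
  next
    case 3
    show ?thesis
      by (rule has_field_derivative_transform_within_open[where f="\<lambda>_. \<rho>1" and S="{l1<..}"])
        (use 3 in \<open>auto simp: R'_def R_right\<close>)
  qed
qed

lemma U_DERIV:
  assumes "\<xi> \<notin> {l0, l1}"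
  shows "(U has_real_derivative - (sound (R \<xi>) / R \<xi> * R' \<xi>)) (at \<xi>)"
proof -
  have "(U has_real_derivative 0 - sound (R \<xi>) / R \<xi> * R' \<xi>) (at \<xi>)"
    unfolding U_def
    by (intro DERIV_diff DERIV_const DERIV_chain2[OF riemann_DERIV] R_pos R_DERIV assms)
  then show ?thesis by simp
qed

text \<open>\<open>clip\<close> differs from the identity only where R' vanishes. This turns the
  eigenvalue, known as \<open>clip \<xi>\<close>, into the factor \<xi> of the relation g' = \<xi>
  f'.\<close>

lemma R'_clip: "clip \<xi> * R' \<xi> = \<xi> * R' \<xi>"
  by (auto simp: R'_def indicator_def clip_def)

text \<open>Since U' = -(c/R) R', the product rule leaves (U - c) R', and U - c is the first
  eigenvalue.\<close>

lemma mass_flux_DERIV: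
  assumes "\<xi> \<notin> {l0, l1}"
  shows "((\<lambda>\<xi>. R \<xi> * U \<xi>) has_real_derivative \<xi> * R' \<xi>) (at \<xi>)"
proof -
  have "((\<lambda>\<xi>. R \<xi> * U \<xi>) has_real_derivative R' \<xi> * U \<xi> + - (sound (R \<xi>) / R \<xi> * R' \<xi>) * R \<xi>) (at \<xi>)"
    by (intro DERIV_mult R_DERIV U_DERIV assms)
  moreover have "R' \<xi> * U \<xi> + - (sound (R \<xi>) / R \<xi> * R' \<xi>) * R \<xi> = (U \<xi> - sound (R \<xi>)) * R' \<xi>"
    using R_pos[of \<xi>] by (simp add: field_simps)
  ultimately show ?thesis by (simp add: U_minus_sound R'_clip)
qed

text \<open>The flux is (R U) U + P with P' = c^2. Differentiation gives \<xi> R' U - c (U - c) R';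
  replacing (U - c) R' by \<xi> R' produces \<xi> (U - c) R', and the same replacement once more
  gives the claim.\<close>

lemma momentum_flux_DERIV:
  assumes "\<xi> \<notin> {l0, l1}"
  shows "((\<lambda>\<xi>. R \<xi> * (U \<xi>)\<^sup>2 + pressure A B \<alpha> (R \<xi>)) has_real_derivative \<xi> * (\<xi> * R' \<xi>)) (at \<xi>)"
proof -
  have eq: "(U \<xi> - sound (R \<xi>)) * R' \<xi> = \<xi> * R' \<xi>"
    by (simp only: U_minus_sound R'_clip)
  have "((\<lambda>\<xi>. (R \<xi> * U \<xi>) * U \<xi> + pressure A B \<alpha> (R \<xi>)) has_real_derivative
      (\<xi> * R' \<xi> * U \<xi> + - (sound (R \<xi>) / R \<xi> * R' \<xi>) * (R \<xi> * U \<xi>)) + (sound (R \<xi>))\<^sup>2 * R' \<xi>) (at \<xi>)"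
    by (intro DERIV_add DERIV_mult mass_flux_DERIV U_DERIV DERIV_chain2[OF pressure_DERIV] R_pos R_DERIV assms)
  moreover have "(\<xi> * R' \<xi> * U \<xi> + - (sound (R \<xi>) / R \<xi> * R' \<xi>) * (R \<xi> * U \<xi>)) + (sound (R \<xi>))\<^sup>2 * R' \<xi>
      = \<xi> * R' \<xi> * U \<xi> - (U \<xi> - sound (R \<xi>)) * R' \<xi> * sound (R \<xi>)"
    using R_pos[of \<xi>] by (simp add: field_simps power2_eq_square)
  also have "\<dots> = \<xi> * R' \<xi> * U \<xi> - \<xi> * R' \<xi> * sound (R \<xi>)"
    by (simp only: eq)
  also have "\<dots> = \<xi> * ((U \<xi> - sound (R \<xi>)) * R' \<xi>)"
    by (simp add: algebra_simps)
  also have "\<dots> = \<xi> * (\<xi> * R' \<xi>)"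
    by (simp only: eq)
  finally show ?thesis by (simp add: power2_eq_square mult_ac)
qed

section \<open>The constructed wave solves the piston problem\<close>

definition V :: "real \<Rightarrow> real \<times> real" where
  "V \<xi> = (R \<xi>, U \<xi>)"

definition gas_measure :: "(real \<times> real) measure" where
  "gas_measure = density lborel (\<lambda>z. ennreal (indicator gas_domain z * R (snd z / fst z)))"

lemma R_U_measurable [measurable]: "R \<in> borel_measurable borel" "U \<in> borel_measurable borel"
  using R_continuous U_continuous by (auto intro: borel_measurable_continuous_onI)

lemma pressure_R_continuous: "continuous_on UNIV (\<lambda>\<xi>. pressure A B \<alpha> (R \<xi>))"
proof -
  have "continuous_on {0<..} (pressure A B \<alpha>)"
    using pressure_DERIV by (intro continuous_at_imp_continuous_on ballI DERIV_isCont) auto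
  then show ?thesis
    by (rule continuous_on_compose2[OF _ R_continuous]) (use R_pos in auto)
qed

lemma pressure_R_bounded: "\<exists>K. \<forall>\<xi>. \<bar>pressure A B \<alpha> (R \<xi>)\<bar> \<le> K"
proof -
  have "compact ((\<lambda>\<xi>. pressure A B \<alpha> (R \<xi>)) ` {l0..l1})"
    by (intro compact_continuous_image continuous_on_subset[OF pressure_R_continuous]) auto
  then obtain K where K: "\<And>\<xi>. \<xi> \<in> {l0..l1} \<Longrightarrow> \<bar>pressure A B \<alpha> (R \<xi>)\<bar> \<le> K"
    using compact_imp_bounded bounded_iff by (metis image_eqI real_norm_def)
  \<comment> \<open>Outside the fan \<open>R\<close> repeats its end values, so the bound on the
    compact fan holds everywhere.\<close>
  have "R \<xi> = R (clip \<xi>)" for \<xi>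
    using speeds_ordered by (intro R_eqI R_pos) (simp add: R_inverse clip_def)
  then show ?thesis using K clip_in by metis
qed

lemma R_abs_le: "\<bar>R \<xi>\<bar> \<le> 1"
  using R_inverse(1)[of \<xi>] \<rho>1_props by auto

lemma U_abs_le: "\<bar>U \<xi>\<bar> \<le> v0"
  using U_bounds[of \<xi>] v0 by auto

lemma R_U_abs_le: "\<bar>R \<xi> * U \<xi>\<bar> \<le> v0"
  using mult_mono[OF R_abs_le[of \<xi>] U_abs_le[of \<xi>]] by (simp add: abs_mult)

lemma R_U_sq_abs_le: "\<bar>R \<xi> * (U \<xi>)\<^sup>2\<bar> \<le> v0 * v0"
  using mult_mono[OF R_U_abs_le[of \<xi>] U_abs_le[of \<xi>]] v0
  by (simp add: abs_mult power2_eq_square mult_ac)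

text \<open>The fan ends at l1 < 0, so U = 0 at \<xi> = 0 and the mass flux vanishes at the piston.
  The identity therefore holds for test functions that do not vanish there, which is what detects
  mass on the piston.\<close>

lemma mass_balance:
  assumes "test_function \<phi>"
  shows "(LINT z:gas_domain|lborel. R (snd z / fst z) * (d_t \<phi> z + U (snd z / fst z) * d_x \<phi> z))
    + (LINT x:{..<0}|lborel. \<phi> (0, x)) = 0"
proof -
  obtain K where K: "\<And>\<xi>. \<bar>R' \<xi>\<bar> \<le> K" using R'_bounded by blast
  have "(LINT z:gas_domain|lborel. R (snd z / fst z) * d_t \<phi> z
      + (R (snd z / fst z) * U (snd z / fst z)) * d_x \<phi> z) + (LINT x:{..<0}|lborel. 1 * \<phi> (0, x)) = 0"
  proof (rule self_similar_balance[where f=R and g="\<lambda>\<xi>. R \<xi> * U \<xi>" and f'=R' and K=K and K'="1 + v0"])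
    show "continuous_on UNIV (\<lambda>\<xi>. R \<xi> * U \<xi>)"
      by (intro continuous_on_mult R_continuous U_continuous)
    show "\<bar>R \<xi>\<bar> \<le> 1 + v0" "\<bar>R \<xi> * U \<xi>\<bar> \<le> 1 + v0" for \<xi>
      using R_abs_le[of \<xi>] R_U_abs_le[of \<xi>] v0 by linarith+
    show "R 0 * U 0 * \<phi> (t, 0) = 0" for t
      using U_right[of 0] speeds_ordered by simp
  qed (use speeds_ordered K assms R_continuous R_DERIV mass_flux_DERIV R'_measurable in \<open>auto simp: R'_def R_left\<close>)
  then show ?thesis by (simp add: algebra_simps)
qed

lemma flux_integrable:
  assumes "test_function \<phi>"
  shows "set_integrable lborel gas_domain (\<lambda>z. R (snd z / fst z) * (d_t \<phi> z + U (snd z / fst z) * d_x \<phi> z))"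
    and "set_integrable lborel gas_domain
      (\<lambda>z. R (snd z / fst z) * (U (snd z / fst z) * d_t \<phi> z + (U (snd z / fst z))\<^sup>2 * d_x \<phi> z))"
    and "set_integrable lborel gas_domain (\<lambda>z. pressure A B \<alpha> (R (snd z / fst z)) * d_x \<phi> z)"
proof -
  note int = set_integrable_test_derivative[OF assms _ _ gas_domain_borel]
  have "set_integrable lborel gas_domain (\<lambda>z. R (snd z / fst z) * d_t \<phi> z)"
    by (rule int(1)[of _ 1]) (simp_all add: R_abs_le)
  moreover have "set_integrable lborel gas_domain (\<lambda>z. (R (snd z / fst z) * U (snd z / fst z)) * d_x \<phi> z)"
    by (rule int(2)[of _ v0]) (simp_all only: R_U_abs_le, measurable)
  ultimately have "set_integrable lborel gas_domain (\<lambda>z. R (snd z / fst z) * d_t \<phi> z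
      + (R (snd z / fst z) * U (snd z / fst z)) * d_x \<phi> z)"
    by (rule set_integral_add)
  then show "set_integrable lborel gas_domain (\<lambda>z. R (snd z / fst z) * (d_t \<phi> z + U (snd z / fst z) * d_x \<phi> z))"
    by (simp add: algebra_simps)
  have "set_integrable lborel gas_domain (\<lambda>z. (R (snd z / fst z) * U (snd z / fst z)) * d_t \<phi> z)"
    by (rule int(1)[of _ v0]) (simp_all only: R_U_abs_le, measurable)
  moreover have "set_integrable lborel gas_domain (\<lambda>z. (R (snd z / fst z) * (U (snd z / fst z))\<^sup>2) * d_x \<phi> z)"
    by (rule int(2)[of _ "v0 * v0"]) (simp_all only: R_U_sq_abs_le, measurable)
  ultimately have "set_integrable lborel gas_domain (\<lambda>z. (R (snd z / fst z) * U (snd z / fst z)) * d_t \<phi> z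
      + (R (snd z / fst z) * (U (snd z / fst z))\<^sup>2) * d_x \<phi> z)"
    by (rule set_integral_add)
  then show "set_integrable lborel gas_domain
      (\<lambda>z. R (snd z / fst z) * (U (snd z / fst z) * d_t \<phi> z + (U (snd z / fst z))\<^sup>2 * d_x \<phi> z))"
    by (simp add: algebra_simps)
  obtain K where K: "\<And>\<xi>. \<bar>pressure A B \<alpha> (R \<xi>)\<bar> \<le> K" using pressure_R_bounded by blast
  have [measurable]: "(\<lambda>\<xi>. pressure A B \<alpha> (R \<xi>)) \<in> borel_measurable borel"
    using pressure_R_continuous by (rule borel_measurable_continuous_onI)
  show "set_integrable lborel gas_domain (\<lambda>z. pressure A B \<alpha> (R (snd z / fst z)) * d_x \<phi> z)"
    by (rule int(2)[of _ K]) (simp_all only: K, measurable)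
qed

text \<open>At \<xi> = 0 the momentum flux is the wall pressure
  \<open>pressure A B \<alpha> \<rho>1\<close>; its boundary term is removed by the vanishing of
  \<open>\<phi>\<close> on the piston.\<close>

lemma momentum_balance:
  assumes \<phi>: "test_function \<phi>" and 0: "\<And>t. \<phi> (t, 0) = 0"
  shows "(LINT z:gas_domain|lborel. R (snd z / fst z) * (U (snd z / fst z) * d_t \<phi> z + (U (snd z / fst z))\<^sup>2 * d_x \<phi> z))
    + (LINT z:gas_domain|lborel. pressure A B \<alpha> (R (snd z / fst z)) * d_x \<phi> z)
    + (LINT x:{..<0}|lborel. - v0 * \<phi> (0, x)) = 0"
proof -
  let ?g = "\<lambda>\<xi>. R \<xi> * (U \<xi>)\<^sup>2 + pressure A B \<alpha> (R \<xi>)"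
  obtain K where K: "\<And>\<xi>. \<bar>R' \<xi>\<bar> \<le> K" using R'_bounded by blast
  obtain P where P: "\<And>\<xi>. \<bar>pressure A B \<alpha> (R \<xi>)\<bar> \<le> P" using pressure_R_bounded by blast
  have "(LINT z:gas_domain|lborel. (R (snd z / fst z) * U (snd z / fst z)) * d_t \<phi> z
      + ?g (snd z / fst z) * d_x \<phi> z) + (LINT x:{..<0}|lborel. - v0 * \<phi> (0, x)) = 0"
  proof (rule self_similar_balance[where f="\<lambda>\<xi>. R \<xi> * U \<xi>" and g="?g" and f'="\<lambda>\<xi>. \<xi> * R' \<xi>"
        and K="\<bar>l0\<bar> * K" and K'="v0 + (v0 * v0 + P)"])
    show "continuous_on UNIV (\<lambda>\<xi>. R \<xi> * U \<xi>)"
      by (intro continuous_on_mult R_continuous U_continuous)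
    show "continuous_on UNIV ?g"
      by (intro continuous_intros R_continuous U_continuous pressure_R_continuous)
    have "0 \<le> P" using P[of 0] by linarith
    then show "\<bar>R \<xi> * U \<xi>\<bar> \<le> v0 + (v0 * v0 + P)" "\<bar>?g \<xi>\<bar> \<le> v0 + (v0 * v0 + P)" for \<xi>
      using R_U_abs_le[of \<xi>] R_U_sq_abs_le[of \<xi>] P[of \<xi>] v0 mult_pos_pos[OF v0 v0] by linarith+
    \<comment> \<open>The factor \<xi> is unbounded, but on the support of R' it equals
      \<open>clip \<xi>\<close>, which is at most |l0| in absolute value.\<close>
    show "\<bar>\<xi> * R' \<xi>\<bar> \<le> \<bar>l0\<bar> * K" for \<xi>
    proof -
      have "0 \<le> K" using K[of 0] by linarith
      moreover have "\<bar>clip \<xi>\<bar> \<le> \<bar>l0\<bar>" using clip_in[of \<xi>] speeds_ordered by auto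
      ultimately have "\<bar>clip \<xi> * R' \<xi>\<bar> \<le> \<bar>l0\<bar> * K"
        unfolding abs_mult using K by (intro mult_mono) auto
      then show ?thesis by (simp only: R'_clip)
    qed
    show "(\<lambda>\<xi>. \<xi> * R' \<xi>) \<in> borel_measurable borel"
      using R'_measurable by measurable
  qed (use speeds_ordered \<phi> 0 mass_flux_DERIV momentum_flux_DERIV in \<open>auto simp: R'_def R_left U_left\<close>)
  moreover have "(LINT z:gas_domain|lborel. (R (snd z / fst z) * U (snd z / fst z)) * d_t \<phi> z
      + ?g (snd z / fst z) * d_x \<phi> z)
    = (LINT z:gas_domain|lborel. R (snd z / fst z) * (U (snd z / fst z) * d_t \<phi> z + (U (snd z / fst z))\<^sup>2 * d_x \<phi> z)
      + pressure A B \<alpha> (R (snd z / fst z)) * d_x \<phi> z)"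
    by (simp add: algebra_simps)
  ultimately show ?thesis
    using set_integral_add(2)[OF flux_integrable(2,3)[OF \<phi>]] by simp
qed

lemma gas_measure_integral:
  assumes int: "set_integrable lborel gas_domain (\<lambda>z. R (snd z / fst z) * h z)"
    and [measurable]: "h \<in> borel_measurable borel"
  shows "set_integrable gas_measure (gas_domain \<union> piston_path) h"
    and "(LINT z:gas_domain \<union> piston_path|gas_measure. h z) = (LINT z:gas_domain|lborel. R (snd z / fst z) * h z)"
proof -
  have nn: "0 \<le> indicator gas_domain z * R (snd z / fst z)" for z
    using R_pos[of "snd z / fst z"] by (auto simp: indicator_def)
  have eq: "(indicator gas_domain z * R (snd z / fst z)) *\<^sub>R (indicator (gas_domain \<union> piston_path) z *\<^sub>R h z)
      = indicator gas_domain z *\<^sub>R (R (snd z / fst z) * h z)" for z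
    by (auto simp: indicator_def)
  show "set_integrable gas_measure (gas_domain \<union> piston_path) h"
    unfolding set_integrable_def gas_measure_def
  proof (subst integrable_density)
    show "integrable lborel (\<lambda>z. (indicator gas_domain z * R (snd z / fst z)) *\<^sub>R
        (indicator (gas_domain \<union> piston_path) z *\<^sub>R h z))"
      using int by (simp only: eq set_integrable_def)
  qed (auto simp: nn)
  show "(LINT z:gas_domain \<union> piston_path|gas_measure. h z) = (LINT z:gas_domain|lborel. R (snd z / fst z) * h z)"
    unfolding set_lebesgue_integral_def gas_measure_def
  proof (subst integral_density)
    show "(\<integral>z. (indicator gas_domain z * R (snd z / fst z)) *\<^sub>R
        (indicator (gas_domain \<union> piston_path) z *\<^sub>R h z) \<partial>lborel)
      = (\<integral>z. indicator gas_domain z *\<^sub>R (R (snd z / fst z) * h z) \<partial>lborel)"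
      by (simp only: eq)
  qed (auto simp: nn)
qed

lemma gas_measure_emeasure:
  assumes [measurable]: "E \<in> sets borel"
  shows "emeasure gas_measure E = (\<integral>\<^sup>+ z. ennreal (indicator gas_domain z * R (snd z / fst z)) * indicator E z \<partial>lborel)"
  unfolding gas_measure_def by (rule emeasure_density) auto

lemma piston_solution_gas_measure:
  "piston_solution A B \<alpha> v0 gas_measure (\<lambda>z. R (snd z / fst z)) (\<lambda>z. U (snd z / fst z))"
  unfolding piston_solution_def
proof (intro conjI allI impI ballI)
  show "sets gas_measure = sets borel" by (simp add: gas_measure_def)
  show "emeasure gas_measure K < \<infinity>" if K: "compact K" for K
  proof -
    have "emeasure gas_measure K \<le> (\<integral>\<^sup>+ z. indicator K z \<partial>lborel)"
      using K R_abs_le unfolding gas_measure_emeasure[OF borel_compact[OF K]]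
      by (intro nn_integral_mono) (auto simp: indicator_def abs_le_iff)
    also have "\<dots> = emeasure lborel K" using borel_compact[OF K] by simp
    also have "\<dots> < \<infinity>" using emeasure_compact_finite[OF K] by simp
    finally show ?thesis .
  qed
  have m: "- (gas_domain \<union> piston_path) \<in> sets borel" by measurable
  have "emeasure gas_measure (- (gas_domain \<union> piston_path)) = (\<integral>\<^sup>+ (z :: real \<times> real). 0 \<partial>lborel)"
    unfolding gas_measure_emeasure[OF m] by (rule nn_integral_cong) (auto simp: indicator_def)
  then show "emeasure gas_measure (- (gas_domain \<union> piston_path)) = 0" by simp
  show "(\<lambda>z. R (snd z / fst z)) \<in> borel_measurable (restrict_space borel (gas_domain \<union> piston_path))"
    "(\<lambda>z. U (snd z / fst z)) \<in> borel_measurable (restrict_space borel (gas_domain \<union> piston_path))"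
    by (rule measurable_restrict_space1, measurable)+
  show "0 < R (snd z / fst z)" for z :: "real \<times> real" by (rule R_pos)
  show "emeasure gas_measure E = (\<integral>\<^sup>+ z \<in> E. ennreal (R (snd z / fst z)) \<partial>lborel)"
    if "E \<in> sets borel" "E \<subseteq> gas_domain" for E
    unfolding gas_measure_emeasure[OF that(1)]
    by (rule nn_integral_cong) (use that in \<open>auto simp: indicator_def\<close>)
  show "R (snd z / fst z) * U (snd z / fst z) = 0" if "z \<in> piston_path" for z
    using that U_right[of 0] speeds_ordered by (auto simp: piston_path_def)
next
  fix \<phi> assume \<phi>: "test_function \<phi>"
  note [measurable] = borel_measurable_test_function[OF \<phi>]
  have m: "(\<lambda>z. d_t \<phi> z + U (snd z / fst z) * d_x \<phi> z) \<in> borel_measurable borel" by measurable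
  note gm = gas_measure_integral[OF flux_integrable(1)[OF \<phi>] m]
  show "set_integrable gas_measure (gas_domain \<union> piston_path) (\<lambda>z. d_t \<phi> z + U (snd z / fst z) * d_x \<phi> z)"
    by (rule gm(1))
  show "(LINT z:gas_domain \<union> piston_path|gas_measure. d_t \<phi> z + U (snd z / fst z) * d_x \<phi> z)
      + (LINT x:{..<0}|lborel. \<phi> (0, x)) = 0"
    using gm(2) mass_balance[OF \<phi>] by simp
next
  fix \<phi> assume "test_function \<phi> \<and> (\<forall>t. \<phi> (t, 0) = 0)"
  then have \<phi>: "test_function \<phi>" "\<And>t. \<phi> (t, 0) = 0" by blast+
  note [measurable] = borel_measurable_test_function[OF \<phi>(1)]
  have m: "(\<lambda>z. U (snd z / fst z) * d_t \<phi> z + (U (snd z / fst z))\<^sup>2 * d_x \<phi> z) \<in> borel_measurable borel" by measurable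
  note gm = gas_measure_integral[OF flux_integrable(2)[OF \<phi>(1)] m]
  show "set_integrable gas_measure (gas_domain \<union> piston_path)
      (\<lambda>z. U (snd z / fst z) * d_t \<phi> z + (U (snd z / fst z))\<^sup>2 * d_x \<phi> z)"
    by (rule gm(1))
  show "set_integrable lborel gas_domain (\<lambda>z. pressure A B \<alpha> (R (snd z / fst z)) * d_x \<phi> z)"
    by (rule flux_integrable(3)[OF \<phi>(1)])
  show "(LINT z:gas_domain \<union> piston_path|gas_measure. U (snd z / fst z) * d_t \<phi> z + (U (snd z / fst z))\<^sup>2 * d_x \<phi> z)
      + (LINT z:gas_domain|lborel. pressure A B \<alpha> (R (snd z / fst z)) * d_x \<phi> z)
      + (LINT x:{..<0}|lborel. - v0 * \<phi> (0, x)) = 0"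
    using gm(2) momentum_balance[OF \<phi>] by simp
qed

lemma eigenvalue_ends: "eigenvalue A B \<alpha> 1 (1, - v0) = l0" "eigenvalue A B \<alpha> 1 (\<rho>1, 0) = l1"
  by (simp_all only: eigenvalue_1 l0_def l1_def fst_conv snd_conv diff_0)

lemma V_ends: "\<xi> \<le> l0 \<Longrightarrow> V \<xi> = (1, - v0)" "l1 \<le> \<xi> \<Longrightarrow> V \<xi> = (\<rho>1, 0)"
  by (simp_all add: V_def R_left R_right U_left U_right)

lemma eigenvalue_V: "eigenvalue A B \<alpha> 1 (V \<xi>) = clip \<xi>"
  by (simp only: eigenvalue_1 V_def fst_conv snd_conv U_minus_sound)

lemma V_C1: "V C1_differentiable_on ({l0<..<l1} \<inter> {..<0})"
proof -
  \<comment> \<open>The derivative without the indicator in \<open>R'\<close>: it agrees with it on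
    the open fan and is continuous on the whole line.\<close>
  define D where "D \<xi> = (inverse (\<Lambda>' (R \<xi>)), - (sound (R \<xi>) / R \<xi> * inverse (\<Lambda>' (R \<xi>))))" for \<xi>
  have "(V has_vector_derivative D \<xi>) (at \<xi>)" if "\<xi> \<in> {l0<..<l1} \<inter> {..<0}" for \<xi>
  proof -
    have "R' \<xi> = inverse (\<Lambda>' (R \<xi>))" "\<xi> \<notin> {l0, l1}" using that by (auto simp: R'_def)
    then show ?thesis
      using R_DERIV[of \<xi>] U_DERIV[of \<xi>]
      unfolding V_def[abs_def] D_def has_real_derivative_iff_has_vector_derivative
      by (auto intro: has_vector_derivative_Pair)
  qed
  moreover have "continuous_on UNIV (\<lambda>\<xi>. sound (R \<xi>))"
    by (rule continuous_on_compose2[OF sound_continuous R_continuous]) (use R_pos in auto)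
  then have "continuous_on UNIV D"
    unfolding D_def using R_pos
    by (intro continuous_intros inverse_\<Lambda>'_R_continuous R_continuous) (auto simp: less_imp_neq[symmetric])
  ultimately show ?thesis
    unfolding C1_differentiable_on_def by (blast intro: continuous_on_subset)
qed

lemma V_classical:
  assumes D: "D \<subseteq> {(t, x). t > 0 \<and> l0 < x / t \<and> x / t < l1}"
  shows "classical_solution_on A B \<alpha> D (\<lambda>(t, x). R (x / t)) (\<lambda>(t, x). U (x / t))"
  unfolding classical_solution_on_def prod.case
proof (rule ballI, clarify)
  fix t x assume "(t, x) \<in> D"
  then have t: "t > 0" and \<xi>: "x / t \<notin> {l0, l1}" using D by auto
  have dt: "((\<lambda>s. x / s) has_real_derivative - x / t\<^sup>2) (at t)"
    using t by (auto intro!: derivative_eq_intros simp: power2_eq_square)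
  have dx: "((\<lambda>y. y / t) has_real_derivative 1 / t) (at x)"
    using t by (auto intro!: derivative_eq_intros)
  let ?r = "R' (x / t)"
  show "\<exists>a b a' b'. ((\<lambda>s. R (x / s)) has_real_derivative a) (at t) \<and>
      ((\<lambda>y. R (y / t) * U (y / t)) has_real_derivative b) (at x) \<and> a + b = 0 \<and>
      ((\<lambda>s. R (x / s) * U (x / s)) has_real_derivative a') (at t) \<and>
      ((\<lambda>y. R (y / t) * (U (y / t))\<^sup>2 + pressure A B \<alpha> (R (y / t))) has_real_derivative b') (at x) \<and>
      a' + b' = 0"
  proof (intro exI conjI)
    show "((\<lambda>s. R (x / s)) has_real_derivative ?r * (- x / t\<^sup>2)) (at t)"
      by (rule DERIV_chain2[OF R_DERIV[OF \<xi>] dt])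
    show "((\<lambda>y. R (y / t) * U (y / t)) has_real_derivative x / t * ?r * (1 / t)) (at x)"
      by (rule DERIV_chain2[OF mass_flux_DERIV[OF \<xi>] dx])
    show "((\<lambda>s. R (x / s) * U (x / s)) has_real_derivative x / t * ?r * (- x / t\<^sup>2)) (at t)"
      by (rule DERIV_chain2[OF mass_flux_DERIV[OF \<xi>] dt])
    show "((\<lambda>y. R (y / t) * (U (y / t))\<^sup>2 + pressure A B \<alpha> (R (y / t))) has_real_derivative
        x / t * (x / t * ?r) * (1 / t)) (at x)"
      by (rule DERIV_chain2[OF momentum_flux_DERIV[OF \<xi>] dx])
    show "?r * (- x / t\<^sup>2) + x / t * ?r * (1 / t) = 0"
      using t by (simp add: field_simps power2_eq_square)
    show "x / t * ?r * (- x / t\<^sup>2) + x / t * (x / t * ?r) * (1 / t) = 0"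
      using t by (simp add: field_simps power2_eq_square)
  qed
qed

lemma rarefaction_wave_V: "rarefaction_wave_solution A B \<alpha> v0 1 \<rho>1 V gas_measure"
  unfolding rarefaction_wave_solution_def Let_def eigenvalue_ends
proof (intro conjI allI impI)
  show "continuous_on {..0} V"
    unfolding V_def[abs_def]
    by (intro continuous_on_Pair continuous_on_subset[OF R_continuous] continuous_on_subset[OF U_continuous]) auto
  show "eigenvalue A B \<alpha> 1 (V \<xi>) = \<xi>" if "l0 \<le> \<xi> \<and> \<xi> < l1" for \<xi>
    unfolding eigenvalue_V using that by (simp add: clip_def)
  show "classical_solution_on A B \<alpha> {(t, x) \<in> gas_domain. l0 < x / t \<and> x / t < l1}
      (\<lambda>(t, x). fst (V (x / t))) (\<lambda>(t, x). snd (V (x / t)))"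
    unfolding V_def fst_conv snd_conv by (rule V_classical) (auto simp: gas_domain_def)
  show "piston_solution A B \<alpha> v0 gas_measure (\<lambda>(t, x). fst (V (x / t))) (\<lambda>(t, x). snd (V (x / t)))"
    using piston_solution_gas_measure by (simp add: V_def case_prod_beta')
qed (auto simp: V_ends \<rho>1_props V_C1)

lemma physically_relevant_V: "physically_relevant A B \<alpha> v0 1 \<rho>1 V"
  unfolding physically_relevant_def eigenvalue_ends
  using clip_in \<rho>1_props by (auto simp only: eigenvalue_V atLeastAtMost_iff)

section \<open>Uniqueness of the wave and absence of concentration\<close>

lemma rarefaction_wave_unique:
  assumes "rarefaction_wave_solution A B \<alpha> v0 i r W \<mu>"
  shows "i = 1 \<and> r = \<rho>1 \<and> (\<forall>\<xi>\<le>0. W \<xi> = V \<xi>)"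
proof -
  define e0 where "e0 = eigenvalue A B \<alpha> i (1, - v0)"
  define e1 where "e1 = eigenvalue A B \<alpha> i (r, 0)"
  have i: "i \<in> {1, 2}" and r: "r > 0" and cont: "continuous_on {..0} W"
    and left: "\<And>\<xi>. \<xi> \<le> 0 \<Longrightarrow> \<xi> < e0 \<Longrightarrow> W \<xi> = (1, - v0)"
    and mid: "\<And>\<xi>. \<xi> \<le> 0 \<Longrightarrow> e0 \<le> \<xi> \<Longrightarrow> \<xi> < e1 \<Longrightarrow> eigenvalue A B \<alpha> i (W \<xi>) = \<xi>"
    and right: "\<And>\<xi>. \<xi> \<le> 0 \<Longrightarrow> e1 < \<xi> \<Longrightarrow> W \<xi> = (r, 0)"
    and C1: "W C1_differentiable_on ({e0<..<e1} \<inter> {..<0})"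
    and classical: "classical_solution_on A B \<alpha> {(t, x) \<in> gas_domain. e0 < x / t \<and> x / t < e1}
      (\<lambda>(t, x). fst (W (x / t))) (\<lambda>(t, x). snd (W (x / t)))"
    and sol: "piston_solution A B \<alpha> v0 \<mu> (\<lambda>(t, x). fst (W (x / t))) (\<lambda>(t, x). snd (W (x / t)))"
    using assms unfolding rarefaction_wave_solution_def Let_def e0_def e1_def by blast+
  \<comment> \<open>At time t = 1 the similarity variable is x itself, so pointwise facts on the
    domain become facts on the profile.\<close>
  have pos: "fst (W \<xi>) > 0" if "\<xi> \<le> 0" for \<xi>
    using piston_solution_pos[OF sol, of "(1, \<xi>)"] that
    by (cases "\<xi> = 0") (auto simp: gas_domain_def piston_path_def)
  have snd0: "snd (W 0) = 0"
    using piston_solution_piston[OF sol, of "(1, 0)"] by (simp add: piston_path_def)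

  have i1: "i = 1"
  proof (rule ccontr)
    assume "i \<noteq> 1"
    then have i2: "i = 2" using i by auto
    have "e1 > 0" unfolding e1_def i2 eigenvalue_2 using sound_pos by simp
    \<comment> \<open>If e0 were positive, the undisturbed state with velocity - v0 would reach the
      piston, where the velocity is 0. So 0 lies in [e0, e1) and the second eigenvalue of
      \<open>W 0\<close> would have to be 0, although it equals the speed of sound.\<close>
    moreover have "\<not> 0 < e0" using left[of 0] snd0 v0 by auto
    ultimately have "eigenvalue A B \<alpha> 2 (W 0) = 0" using mid[of 0] i2 by simp
    then show False using snd0 sound_pos[of "fst (W 0)"] by (simp add: eigenvalue_2)
  qed
  have e0: "e0 = l0" unfolding e0_def i1 by (rule eigenvalue_ends)
  have e1: "e1 = - sound r" unfolding e1_def i1 eigenvalue_1 by simp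
  have e1_neg: "e1 < 0" using e1 sound_pos[of r] by simp
  have l0_neg: "l0 < 0" using speeds_ordered by simp

  \<comment> \<open>The left state is prescribed only on \<xi> < l0; continuity carries it to the
    edge. The same argument gives the right state at e1 next.\<close>
  have W_l0: "W l0 = (1, - v0)"
  proof (rule continuous_constant_on_closure[of "{..<l0}"])
    show "continuous_on (closure {..<l0}) W"
      by (rule continuous_on_subset[OF cont]) (use l0_neg in auto)
  qed (use left e0 l0_neg in auto)
  have W_right: "W \<xi> = (r, 0)" if "e1 \<le> \<xi>" "\<xi> \<le> 0" for \<xi>
  proof (rule continuous_constant_on_closure[of "{e1<..<0}"])
    show "continuous_on (closure {e1<..<0}) W"
      by (rule continuous_on_subset[OF cont]) (use e1_neg in auto)
  qed (use right that e1_neg in auto)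
  \<comment> \<open>Otherwise both constant states would be attained at l0, although their
    velocities - v0 and 0 differ.\<close>
  have l0_e1: "l0 < e1"
    using W_l0 W_right[of l0] l0_neg v0 by (cases "l0 < e1") auto

  define H where "H \<xi> = snd (W \<xi>) + riemann (fst (W \<xi>))" for \<xi>
  have H: "H \<xi> = riemann 1 - v0" if \<xi>: "l0 \<le> \<xi>" "\<xi> \<le> e1" for \<xi>
  proof -
    have "H \<xi> = H l0"
    proof (rule DERIV_isconst2[OF l0_e1 _ _ \<xi>])
      have sub: "continuous_on {l0..e1} W"
        by (rule continuous_on_subset[OF cont]) (use e1_neg in auto)
      show "continuous_on {l0..e1} H"
        unfolding H_def
        by (intro continuous_intros sub continuous_on_compose2[OF riemann_continuous])
          (use pos e1_neg in auto)
      fix \<eta> assume \<eta>: "l0 < \<eta>" "\<eta> < e1"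
      then have neg: "\<eta> < 0" using e1_neg by simp
      obtain D' where "\<forall>x\<in>{e0<..<e1} \<inter> {..<0}. (W has_vector_derivative D' x) (at x)"
        using C1 unfolding C1_differentiable_on_def by blast
      moreover define D where "D = D' \<eta>"
      ultimately have "(W has_vector_derivative D) (at \<eta>)"
        using \<eta> neg e0 by simp
      then have dR: "((\<lambda>\<xi>. fst (W \<xi>)) has_real_derivative fst D) (at \<eta>)"
        and dU: "((\<lambda>\<xi>. snd (W \<xi>)) has_real_derivative snd D) (at \<eta>)"
        unfolding has_real_derivative_iff_has_vector_derivative
        by (auto intro: bounded_linear.has_vector_derivative[OF bounded_linear_fst]
            bounded_linear.has_vector_derivative[OF bounded_linear_snd])
      have "(1, \<eta>) \<in> {(t, x) \<in> gas_domain. e0 < x / t \<and> x / t < e1}"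
        using \<eta> neg e0 by (simp add: gas_domain_def)
      \<comment> \<open>The mass equation at the point (1, \<eta>), where the t-derivative of
        \<rho>(x/t) is - \<eta> \<rho>'.\<close>
      with classical obtain a b where ab: "((\<lambda>s. fst (W (\<eta> / s))) has_real_derivative a) (at 1)"
          "((\<lambda>y. fst (W y) * snd (W y)) has_real_derivative b) (at \<eta>)" "a + b = 0"
        unfolding classical_solution_on_def by fastforce
      have "((\<lambda>s. \<eta> / s) has_real_derivative - \<eta>) (at 1)"
        by (auto intro!: derivative_eq_intros)
      from DERIV_chain2[of "\<lambda>\<xi>. fst (W \<xi>)", OF _ this] dR
      have "((\<lambda>s. fst (W (\<eta> / s))) has_real_derivative fst D * - \<eta>) (at 1)"
        by simp
      then have a: "a = fst D * - \<eta>" using ab(1) DERIV_unique by blast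
      have b: "b = fst D * snd (W \<eta>) + snd D * fst (W \<eta>)"
        using DERIV_unique[OF ab(2) DERIV_mult[OF dR dU]] .
      have "snd (W \<eta>) - sound (fst (W \<eta>)) = \<eta>"
        using mid[of \<eta>] \<eta> neg e0 unfolding i1 eigenvalue_1 by simp
      then have s: "sound (fst (W \<eta>)) = snd (W \<eta>) - \<eta>" by simp
      \<comment> \<open>With c = u - \<eta> on the fan, the mass equation (u - \<eta>) \<rho>' +
        \<rho> u' = 0 divided by \<rho> is exactly the vanishing derivative of
        \<open>H\<close>.\<close>
      have "snd D + sound (fst (W \<eta>)) / fst (W \<eta>) * fst D = (a + b) / fst (W \<eta>)"
        unfolding a b s using pos[of \<eta>] neg by (simp add: field_simps)
      then have 0: "snd D + sound (fst (W \<eta>)) / fst (W \<eta>) * fst D = 0" using ab(3) by simp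
      have "(H has_real_derivative snd D + sound (fst (W \<eta>)) / fst (W \<eta>) * fst D) (at \<eta>)"
        unfolding H_def using pos[of \<eta>] neg
        by (intro DERIV_add dU DERIV_chain2[OF riemann_DERIV dR]) auto
      then show "(H has_real_derivative 0) (at \<eta>)" by (simp only: 0)
    qed
    then show ?thesis by (simp add: H_def W_l0)
  qed

  have "riemann r = riemann 1 - v0"
    using H[of e1] W_right[of e1] l0_e1 e1_neg by (simp add: H_def)
  then have r1: "r = \<rho>1" using r by (rule \<rho>1_unique[rotated])
  have e1': "e1 = l1" by (simp add: e1 r1 l1_def)
  have "W \<xi> = V \<xi>" if "\<xi> \<le> 0" for \<xi>
  proof -
    consider "\<xi> < l0" | "l0 \<le> \<xi>" "\<xi> < l1" | "l1 \<le> \<xi>" by linarith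
    then show ?thesis
    proof cases
      case 1
      then show ?thesis using left[OF that] e0 V_ends by simp
    next
      case 2
      have s: "snd (W \<xi>) = riemann 1 - v0 - riemann (fst (W \<xi>))"
        using H[of \<xi>] 2 e1' by (simp add: H_def)
      have "snd (W \<xi>) - sound (fst (W \<xi>)) = \<xi>"
        using mid[OF that] 2 e0 e1' unfolding i1 eigenvalue_1 by simp
      then have "\<Lambda> (fst (W \<xi>)) = clip \<xi>"
        using 2 by (simp add: \<Lambda>_def s clip_def)
      then have "R \<xi> = fst (W \<xi>)" using pos[OF that] by (rule R_eqI[rotated])
      then show ?thesis by (simp add: V_def U_def s prod_eq_iff)
    next
      case 3
      then show ?thesis using W_right[of \<xi>] that e1' r1 V_ends by simp
    qed
  qed
  with i1 r1 show ?thesis by blast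
qed

lemma rarefaction_wave_no_mass:
  assumes "rarefaction_wave_solution A B \<alpha> v0 i r W \<mu>"
  shows "emeasure \<mu> piston_path = 0"
    and "\<mu> = gas_measure"
proof -
  have W: "W \<xi> = V \<xi>" if "\<xi> \<le> 0" for \<xi>
    using rarefaction_wave_unique[OF assms] that by blast
  \<comment> \<open>Stated for any solution with this profile in the interior, because it is applied
    both to \<open>\<mu>\<close> and to \<open>gas_measure\<close>; with the piston null for both,
    the two measures coincide.\<close>
  have no_mass: "emeasure \<mu>' piston_path = 0"
    if sol: "piston_solution A B \<alpha> v0 \<mu>' \<rho> u"
      and eq: "\<And>t x. 0 < t \<Longrightarrow> x < 0 \<Longrightarrow> \<rho> (t, x) = R (x / t) \<and> u (t, x) = U (x / t)" for \<mu>' \<rho> u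
  proof (rule piston_solution_no_mass[OF sol])
    fix \<phi> assume \<phi>: "test_function \<phi>"
    have "(LINT z:gas_domain|lborel. \<rho> z * (d_t \<phi> z + u z * d_x \<phi> z))
        = (LINT z:gas_domain|lborel. R (snd z / fst z) * (d_t \<phi> z + U (snd z / fst z) * d_x \<phi> z))"
      by (rule set_lebesgue_integral_cong, simp) (auto simp: gas_domain_def eq)
    then show "(LINT z:gas_domain|lborel. \<rho> z * (d_t \<phi> z + u z * d_x \<phi> z)) + (LINT x:{..<0}|lborel. \<phi> (0, x)) = 0"
      using mass_balance[OF \<phi>] by simp
  qed
  have sol: "piston_solution A B \<alpha> v0 \<mu> (\<lambda>(t, x). fst (W (x / t))) (\<lambda>(t, x). snd (W (x / t)))"
    using assms unfolding rarefaction_wave_solution_def Let_def by blast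
  have W': "W (x / t) = V (x / t)" if "0 < t" "x < 0" for t x :: real
    using that by (intro W divide_nonpos_pos) auto
  show 0: "emeasure \<mu> piston_path = 0"
    by (rule no_mass[OF sol]) (simp add: W' V_def)
  have "emeasure gas_measure piston_path = 0"
    by (rule no_mass[OF piston_solution_gas_measure]) simp
  from piston_solution_measure_unique[OF sol 0 piston_solution_gas_measure this]
  show "\<mu> = gas_measure" by (auto simp: gas_domain_def W' V_def)
qed

end

theorem theorem4p2:
  fixes A B \<alpha> v0 M0 :: real
  assumes "0 < \<alpha>" and "\<alpha> < 1"
    and "A > 0" and "B > 0"
    and "v0 = sqrt 2"
    and "M0 > 0" and "A + B * \<alpha> = 2 / M0\<^sup>2"
  shows "(\<exists>i \<rho>1 V \<mu>.
            rarefaction_wave_solution A B \<alpha> v0 i \<rho>1 V \<mu> \<and>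
            physically_relevant A B \<alpha> v0 i \<rho>1 V \<and>
            (\<forall>i' \<rho>1' V' \<mu>'.
               rarefaction_wave_solution A B \<alpha> v0 i' \<rho>1' V' \<mu>' \<and>
               physically_relevant A B \<alpha> v0 i' \<rho>1' V' \<longrightarrow>
               i' = i \<and> \<rho>1' = \<rho>1 \<and> (\<forall>\<xi> \<le> 0. V' \<xi> = V \<xi>) \<and> \<mu>' = \<mu>)) \<and>
         (\<forall>i \<rho>1 V \<mu>. rarefaction_wave_solution A B \<alpha> v0 i \<rho>1 V \<mu> \<longrightarrow>
            \<not> concentrates_on_piston \<mu>)"
proof -
  interpret receding_piston A B \<alpha> v0
    using assms by unfold_locales simp_all
  show ?thesis
  proof (intro conjI exI allI impI)
    show "rarefaction_wave_solution A B \<alpha> v0 1 \<rho>1 V gas_measure" by (rule rarefaction_wave_V)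
    show "physically_relevant A B \<alpha> v0 1 \<rho>1 V" by (rule physically_relevant_V)
  next
    fix i' \<rho>1' V' \<mu>'
    assume "rarefaction_wave_solution A B \<alpha> v0 i' \<rho>1' V' \<mu>' \<and> physically_relevant A B \<alpha> v0 i' \<rho>1' V'"
    then have wave: "rarefaction_wave_solution A B \<alpha> v0 i' \<rho>1' V' \<mu>'" ..
    show "i' = 1" "\<rho>1' = \<rho>1" "\<And>\<xi>. \<xi> \<le> 0 \<Longrightarrow> V' \<xi> = V \<xi>" "\<mu>' = gas_measure"
      using rarefaction_wave_unique[OF wave] rarefaction_wave_no_mass(2)[OF wave] by blast+
  next
    show "\<not> concentrates_on_piston \<mu>" if "rarefaction_wave_solution A B \<alpha> v0 i r W \<mu>" for i r W \<mu>
      using rarefaction_wave_no_mass(1)[OF that] by (simp add: concentrates_on_piston_def)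
  qed
qed

end
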